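(* Every Inoue surface $S$ of type $S^-$ has a para-hypercomplex structure $\{J_1,J_2,J_3\}$ which does not admit a compatible metric, i.e. there is no pseudo-Riemannian metric $g$ on $S$ such that $$g(J_1X,J_1Y)=-g(J_2X,J_2Y)=-g(J_3X,J_3Y)=g(X,Y)$$ for all tangent vectors $X,Y$ at any point of $S$.
   Context: An almost para-hypercomplex structure on a smooth $4$-manifold $M$ is a triple $\{J_1,J_2,J_3\}$ of smooth endomorphisms of the tangent bundle $TM$ such that $J_1^2=-J_2^2=-J_3^2=-\mathrm{Id}$ and $J_1J_2=-J_2J_1=J_3$. It is called para-hypercomplex if the structures are integrable, i.e. the Nijenhuis tensors of $J_1,J_2,J_3$ vanish. Inoue surfaces of type $S^-$: let $p,q,r$ be integers with $r\neq 0$, and let $N=(n_{ij})\in GL(2,\mathbb{Z})$ be a matrix with $\det N=-1$ and real eigenvalues $\alpha>1$ and $-1/\alpha$. Let $(a_1,a_2)$ and $(b_1,b_2)$ be real eigenvectors of $N$ corresponding to $\alpha$ and $-1/\alpha$ respectively, and set $A=(b_1a_2-b_2a_1)/r$. Let $(c_1,c_2)\in\mathbb{R}^2$ be the solution of $$-c_i=n_{i1}c_1+n_{i2}c_2+e_i+A\,p_i,\quad i=1,2,\qquad (p_1,p_2)=(p,q),$$ where $e_i=\tfrac12 n_{i1}(n_{i1}-1)a_1b_1+\tfrac12 n_{i2}(n_{i2}-1)a_2b_2+n_{i1}n_{i2}b_1a_2$. Let $\mathbb{H}$ be the upper half-plane in $\mathbb{C}$. The Inoue surface of type $S^-$ with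 these data is the quotient of $\mathbb{H}\times\mathbb{C}$ by the group generated by the transformations $$\phi_0(z,w)=(\alpha z,-w),\quad \phi_i(z,w)=(z+a_i,\,w+b_iz+c_i)\ (i=1,2),\quad \phi_3(z,w)=(z,w+A).$$ This group acts freely, properly discontinuously and cocompactly, so the quotient is a compact complex surface. *)

theory Defs
  imports "HOL-Analysis.Analysis" "HOL-Algebra.Group_Action" "HOL-Algebra.Generated_Groups"
begin

section \<open>Smooth maps on open subsets of Euclidean spaces\<close>

text \<open>Meaningful for open sets only, since derivatives are taken at interior points.\<close>

primrec Ck_on ::
  "nat \<Rightarrow> ('e::euclidean_space \<Rightarrow> 'f::real_normed_vector) \<Rightarrow> 'e set \<Rightarrow> bool" where
  "Ck_on 0 f S \<longleftrightarrow> continuous_on S f"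
| "Ck_on (Suc k) f S \<longleftrightarrow>
     (\<forall>x\<in>S. f differentiable (at x)) \<and>
     (\<forall>v. Ck_on k (\<lambda>x. frechet_derivative f (at x) v) S)"

definition smooth_on ::
  "('e::euclidean_space \<Rightarrow> 'f::real_normed_vector) \<Rightarrow> 'e set \<Rightarrow> bool" where
  "smooth_on f S \<longleftrightarrow> (\<forall>k. Ck_on k f S)"

section \<open>Smooth manifolds given by an atlas\<close>

text \<open>A chart is a pair of its domain and its coordinate map; the values of the coordinate map
  outside of the domain are irrelevant.\<close>

type_synonym ('a, 'e) chart = "'a set \<times> ('a \<Rightarrow> 'e)"

abbreviation chart_dom :: "('a, 'e) chart \<Rightarrow> 'a set" where
  "chart_dom \<equiv> fst"

abbreviation chart_map :: "('a, 'e) chart \<Rightarrow> 'a \<Rightarrow> 'e" where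
  "chart_map \<equiv> snd"

definition chart_im :: "('a, 'e) chart \<Rightarrow> 'e set" where
  "chart_im c = chart_map c ` chart_dom c"

definition transition :: "('a, 'e) chart \<Rightarrow> ('a, 'e) chart \<Rightarrow> 'e \<Rightarrow> 'e" where
  "transition c d = chart_map d \<circ> inv_into (chart_dom c) (chart_map c)"

definition smooth_manifold ::
  "'a topology \<Rightarrow> ('a, 'e::euclidean_space) chart set \<Rightarrow> bool" where
  "smooth_manifold X \<A> \<longleftrightarrow>
     Hausdorff_space X \<and> second_countable X \<and>
     topspace X = (\<Union>c\<in>\<A>. chart_dom c) \<and>
     (\<forall>c\<in>\<A>. openin X (chart_dom c) \<and> open (chart_im c) \<and>
        homeomorphic_map (subtopology X (chart_dom c)) (top_of_set (chart_im c)) (chart_map c)) \<and>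
     (\<forall>c\<in>\<A>. \<forall>d\<in>\<A>. smooth_on (transition c d) (chart_map c ` (chart_dom c \<inter> chart_dom d)))"

section \<open>Tensor fields\<close>

text \<open>A tangent vector at a point \<open>x\<close> is given by its components \<open>v\<close> in a chart \<open>c\<close> around \<open>x\<close>,
  its components in another chart \<open>d\<close> being \<open>tangent_change c d x v\<close>. Accordingly a tensor field
  is given by its components: \<open>J c y\<close> acts on the components (with respect to \<open>c\<close>) of tangent
  vectors at the point whose coordinates are \<open>y \<in> chart_im c\<close>.\<close>

definition tangent_change ::
  "('a, 'e::euclidean_space) chart \<Rightarrow> ('a, 'e) chart \<Rightarrow> 'a \<Rightarrow> 'e \<Rightarrow> 'e" where
  "tangent_change c d x = frechet_derivative (transition c d) (at (chart_map c x))"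

type_synonym ('a, 'e) endo_field = "('a, 'e) chart \<Rightarrow> 'e \<Rightarrow> 'e \<Rightarrow> 'e"
type_synonym ('a, 'e) bilin_field = "('a, 'e) chart \<Rightarrow> 'e \<Rightarrow> 'e \<Rightarrow> 'e \<Rightarrow> real"

definition smooth_endomorphism ::
  "('a, 'e::euclidean_space) chart set \<Rightarrow> ('a, 'e) endo_field \<Rightarrow> bool" where
  "smooth_endomorphism \<A> J \<longleftrightarrow>
     (\<forall>c\<in>\<A>. (\<forall>y\<in>chart_im c. linear (J c y)) \<and>
             (\<forall>v. smooth_on (\<lambda>y. J c y v) (chart_im c))) \<and>
     (\<forall>c\<in>\<A>. \<forall>d\<in>\<A>. \<forall>x\<in>chart_dom c \<inter> chart_dom d. \<forall>v.
        J d (chart_map d x) (tangent_change c d x v) =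
          tangent_change c d x (J c (chart_map c x) v))"

definition pseudo_Riemannian_metric ::
  "('a, 'e::euclidean_space) chart set \<Rightarrow> ('a, 'e) bilin_field \<Rightarrow> bool" where
  "pseudo_Riemannian_metric \<A> g \<longleftrightarrow>
     (\<forall>c\<in>\<A>. (\<forall>y\<in>chart_im c. bilinear (g c y) \<and>
               (\<forall>u v. g c y u v = g c y v u) \<and>
               (\<forall>u. (\<forall>v. g c y u v = 0) \<longrightarrow> u = 0)) \<and>
             (\<forall>u v. smooth_on (\<lambda>y. g c y u v) (chart_im c))) \<and>
     (\<forall>c\<in>\<A>. \<forall>d\<in>\<A>. \<forall>x\<in>chart_dom c \<inter> chart_dom d. \<forall>u v.
        g d (chart_map d x) (tangent_change c d x u) (tangent_change c d x v) =
          g c (chart_map c x) u v)"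

definition Lie_bracket ::
  "('e::euclidean_space \<Rightarrow> 'e) \<Rightarrow> ('e \<Rightarrow> 'e) \<Rightarrow> 'e \<Rightarrow> 'e" where
  "Lie_bracket X Y y = frechet_derivative Y (at y) (X y) - frechet_derivative X (at y) (Y y)"

definition Nijenhuis ::
  "('e::euclidean_space \<Rightarrow> 'e \<Rightarrow> 'e) \<Rightarrow> ('e \<Rightarrow> 'e) \<Rightarrow> ('e \<Rightarrow> 'e) \<Rightarrow> 'e \<Rightarrow> 'e" where
  "Nijenhuis J X Y y =
     Lie_bracket (\<lambda>z. J z (X z)) (\<lambda>z. J z (Y z)) y
     - J y (Lie_bracket (\<lambda>z. J z (X z)) Y y)
     - J y (Lie_bracket X (\<lambda>z. J z (Y z)) y)
     + J y (J y (Lie_bracket X Y y))"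

definition integrable_endomorphism ::
  "('a, 'e::euclidean_space) chart set \<Rightarrow> ('a, 'e) endo_field \<Rightarrow> bool" where
  "integrable_endomorphism \<A> J \<longleftrightarrow>
     (\<forall>c\<in>\<A>. \<forall>X Y. smooth_on X (chart_im c) \<longrightarrow> smooth_on Y (chart_im c) \<longrightarrow>
        (\<forall>y\<in>chart_im c. Nijenhuis (J c) X Y y = 0))"

section \<open>Para-hypercomplex structures\<close>

definition almost_para_hypercomplex ::
  "'a topology \<Rightarrow> ('a, 'e::euclidean_space) chart set \<Rightarrow>
   ('a, 'e) endo_field \<Rightarrow> ('a, 'e) endo_field \<Rightarrow> ('a, 'e) endo_field \<Rightarrow> bool" where
  "almost_para_hypercomplex X \<A> J1 J2 J3 \<longleftrightarrow>
     smooth_manifold X \<A> \<and> DIM('e) = 4 \<and>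
     smooth_endomorphism \<A> J1 \<and> smooth_endomorphism \<A> J2 \<and> smooth_endomorphism \<A> J3 \<and>
     (\<forall>c\<in>\<A>. \<forall>y\<in>chart_im c. \<forall>v.
        J1 c y (J1 c y v) = - v \<and> J2 c y (J2 c y v) = v \<and> J3 c y (J3 c y v) = v \<and>
        J1 c y (J2 c y v) = - J2 c y (J1 c y v) \<and> J1 c y (J2 c y v) = J3 c y v)"

definition para_hypercomplex ::
  "'a topology \<Rightarrow> ('a, 'e::euclidean_space) chart set \<Rightarrow>
   ('a, 'e) endo_field \<Rightarrow> ('a, 'e) endo_field \<Rightarrow> ('a, 'e) endo_field \<Rightarrow> bool" where
  "para_hypercomplex X \<A> J1 J2 J3 \<longleftrightarrow>
     almost_para_hypercomplex X \<A> J1 J2 J3 \<and>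
     integrable_endomorphism \<A> J1 \<and> integrable_endomorphism \<A> J2 \<and>
     integrable_endomorphism \<A> J3"

definition compatible_metric ::
  "('a, 'e::euclidean_space) chart set \<Rightarrow>
   ('a, 'e) endo_field \<Rightarrow> ('a, 'e) endo_field \<Rightarrow> ('a, 'e) endo_field \<Rightarrow>
   ('a, 'e) bilin_field \<Rightarrow> bool" where
  "compatible_metric \<A> J1 J2 J3 g \<longleftrightarrow>
     pseudo_Riemannian_metric \<A> g \<and>
     (\<forall>c\<in>\<A>. \<forall>y\<in>chart_im c. \<forall>u v.
        g c y (J1 c y u) (J1 c y v) = g c y u v \<and>
        - g c y (J2 c y u) (J2 c y v) = g c y u v \<and>
        - g c y (J3 c y u) (J3 c y v) = g c y u v)"

section \<open>Quotients by groups of transformations\<close>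

text \<open>Here \<open>G\<close> is a group whose elements are transformations of an open set \<open>E\<close>. The charts of
  the quotient are the inverses of the restrictions of the projection to those open subsets of
  \<open>E\<close> on which it is injective; they cover the quotient if \<open>G\<close> acts freely and properly
  discontinuously.\<close>

abbreviation quot_proj :: "('e \<Rightarrow> 'e) monoid \<Rightarrow> 'e \<Rightarrow> 'e set" where
  "quot_proj G \<equiv> orbit G (\<lambda>f. f)"

definition quot_topology ::
  "('e::topological_space \<Rightarrow> 'e) monoid \<Rightarrow> 'e set \<Rightarrow> 'e set topology" where
  "quot_topology G E =
     topology (\<lambda>W. W \<subseteq> orbits G E (\<lambda>f. f) \<and> openin (top_of_set E) {x \<in> E. quot_proj G x \<in> W})"

definition quot_atlas ::
  "('e::topological_space \<Rightarrow> 'e) monoid \<Rightarrow> 'e set \<Rightarrow> ('e set, 'e) chart set" where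
  "quot_atlas G E =
     {(quot_proj G ` U, inv_into U (quot_proj G)) | U. open U \<and> U \<subseteq> E \<and> inj_on (quot_proj G) U}"

lemma quotient_map_quot_topology:
  "quotient_map (top_of_set E) (quot_topology G E) (quot_proj G)"
proof -
  let ?P = "\<lambda>W. W \<subseteq> orbits G E (\<lambda>f. f) \<and> openin (top_of_set E) {x \<in> E. quot_proj G x \<in> W}"
  have "istopology ?P"
    unfolding istopology_def
  proof (intro conjI allI impI; (elim conjE)?)
    fix S T
    assume "openin (top_of_set E) {x \<in> E. quot_proj G x \<in> S}"
      and "openin (top_of_set E) {x \<in> E. quot_proj G x \<in> T}"
    moreover have "{x \<in> E. quot_proj G x \<in> S \<inter> T}
        = {x \<in> E. quot_proj G x \<in> S} \<inter> {x \<in> E. quot_proj G x \<in> T}"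
      by blast
    ultimately show "openin (top_of_set E) {x \<in> E. quot_proj G x \<in> S \<inter> T}"
      by (simp only: openin_Int)
  next
    fix \<K>
    assume "\<forall>K\<in>\<K>. ?P K"
    moreover have "{x \<in> E. quot_proj G x \<in> \<Union>\<K>} = (\<Union>K\<in>\<K>. {x \<in> E. quot_proj G x \<in> K})"
      by blast
    ultimately show "openin (top_of_set E) {x \<in> E. quot_proj G x \<in> \<Union>\<K>}"
      by (metis (no_types, lifting) openin_Union imageE)
  qed blast+
  then have open_iff: "openin (quot_topology G E) W \<longleftrightarrow> ?P W" for W
    unfolding quot_topology_def by (simp add: topology_inverse')
  have img: "quot_proj G ` E = orbits G E (\<lambda>f. f)"
    unfolding orbits_def by blast
  have "{x \<in> E. quot_proj G x \<in> orbits G E (\<lambda>f. f)} = E"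
    using img by blast
  then have "openin (quot_topology G E) (orbits G E (\<lambda>f. f))"
    by (simp add: open_iff)
  then have "topspace (quot_topology G E) = orbits G E (\<lambda>f. f)"
    using open_iff[of "topspace (quot_topology G E)"]
    by (intro subset_antisym openin_subset) (simp_all only: openin_topspace simp_thms)
  then show ?thesis
    unfolding quotient_map_def by (simp add: img open_iff)
qed

section \<open>Inoue surfaces of type \<open>S\<^sup>-\<close>\<close>

definition inoue_space :: "(complex \<times> complex) set" where
  "inoue_space = {z. Im z > 0} \<times> UNIV"

definition inoue_A :: "int \<Rightarrow> real^2 \<Rightarrow> real^2 \<Rightarrow> real" where
  "inoue_A r a b = (b$1 * a$2 - b$2 * a$1) / r"

definition inoue_e :: "int^2^2 \<Rightarrow> real^2 \<Rightarrow> real^2 \<Rightarrow> real^2" where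
  "inoue_e N a b = (\<chi> i. 1/2 * (N$i$1 * (N$i$1 - 1)) * a$1 * b$1
                       + 1/2 * (N$i$2 * (N$i$2 - 1)) * a$2 * b$2
                       + N$i$1 * N$i$2 * b$1 * a$2)"

definition inoue_phi0 :: "real \<Rightarrow> complex \<times> complex \<Rightarrow> complex \<times> complex" where
  "inoue_phi0 \<alpha> = restrict (\<lambda>(z, w). (of_real \<alpha> * z, - w)) inoue_space"

definition inoue_phi ::
  "real^2 \<Rightarrow> real^2 \<Rightarrow> real^2 \<Rightarrow> 2 \<Rightarrow> complex \<times> complex \<Rightarrow> complex \<times> complex" where
  "inoue_phi a b c i =
     restrict (\<lambda>(z, w). (z + of_real (a$i), w + of_real (b$i) * z + of_real (c$i))) inoue_space"

definition inoue_phi3 :: "real \<Rightarrow> complex \<times> complex \<Rightarrow> complex \<times> complex" where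
  "inoue_phi3 A = restrict (\<lambda>(z, w). (z, w + of_real A)) inoue_space"

definition inoue_group ::
  "real \<Rightarrow> real^2 \<Rightarrow> real^2 \<Rightarrow> real^2 \<Rightarrow> real \<Rightarrow> (complex \<times> complex \<Rightarrow> complex \<times> complex) monoid"
where
  "inoue_group \<alpha> a b c A =
     BijGroup inoue_space
       \<lparr>carrier := generate (BijGroup inoue_space)
          {inoue_phi0 \<alpha>, inoue_phi a b c 1, inoue_phi a b c 2, inoue_phi3 A}\<rparr>"

text \<open>The underlying smooth manifold of the Inoue surface: its topology and its atlas, with
  \<open>\<complex> \<times> \<complex>\<close> as a real Euclidean space of dimension 4 serving as the model.\<close>

definition inoue_topology ::
  "real \<Rightarrow> real^2 \<Rightarrow> real^2 \<Rightarrow> real^2 \<Rightarrow> real \<Rightarrow> (complex \<times> complex) set topology" where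
  "inoue_topology \<alpha> a b c A = quot_topology (inoue_group \<alpha> a b c A) inoue_space"

definition inoue_atlas ::
  "real \<Rightarrow> real^2 \<Rightarrow> real^2 \<Rightarrow> real^2 \<Rightarrow> real \<Rightarrow>
   ((complex \<times> complex) set, complex \<times> complex) chart set" where
  "inoue_atlas \<alpha> a b c A = quot_atlas (inoue_group \<alpha> a b c A) inoue_space"

end

theory Submission
  imports Defs
begin

text \<open>The group acts on \<open>\<H> \<times> \<complex>\<close> by maps whose differentials are matrices \<open>(\<zeta>, \<omega>) \<mapsto> (t \<zeta>, \<plusminus>\<omega> + u \<zeta>)\<close>
  with \<^emph>\<open>real\<close> entries. They commute with \<open>J\<^sub>1 = \<i>\<close>, with complex conjugation \<open>J\<^sub>2\<close> and with
  \<open>J\<^sub>3 = J\<^sub>1 J\<^sub>2\<close>, so these constant endomorphisms descend to the quotient, where they are integrable.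

  A metric \<open>g\<close> compatible with them satisfies \<open>h = g((1, 0), (0, \<i>)) \<noteq> 0\<close> everywhere: all the other
  products of \<open>(1, 0)\<close> with basis vectors vanish. But \<open>\<phi>\<^sub>0\<close> multiplies \<open>(1, 0)\<close> by \<open>\<alpha> > 0\<close> and
  \<open>(0, \<i>)\<close> by \<open>-1\<close>, so it reverses the sign of \<open>h\<close>, which is impossible on the connected space
  \<open>\<H> \<times> \<complex>\<close>.

  That the quotient is a manifold rests on proper discontinuity. The pairs \<open>(a\<^sub>i, b\<^sub>i)\<close> span
  a lattice in \<open>\<real>\<^sup>2\<close> invariant under \<open>diag(\<alpha>, -1/\<alpha>)\<close>, and the remaining translation parts lie in a
  discrete subgroup of \<open>\<real>\<close>.\<close>

section \<open>Locally affine maps and constant endomorphisms\<close>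

text \<open>The derivative of a locally affine map is locally constant, hence again locally affine,
  so induction on the order works with \<open>f\<close> generalised. This covers the transition maps
  of the quotient as well as constant components.\<close>

lemma locally_affine_Ck_on:
  fixes f :: "'e::euclidean_space \<Rightarrow> 'f::real_normed_vector"
  assumes "\<And>x. x \<in> S \<Longrightarrow> \<exists>T L k. open T \<and> x \<in> T \<and> linear L \<and> (\<forall>y\<in>T. f y = L y + k)"
  shows "Ck_on n f S"
  using assms
proof (induction n arbitrary: f)
  case (0 f)
  have "continuous (at x within S) f" if x: "x \<in> S" for x
  proof -
    obtain T L k where T: "open T" "x \<in> T" "linear L" "\<forall>y\<in>T. f y = L y + k"
      using "0.prems"[OF x] by metis
    have "continuous_on T (\<lambda>y. L y + k)"
      using T(3) by (intro continuous_on_add continuous_on_const linear_continuous_on)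
        (simp add: linear_linear)
    then have "continuous_on T f"
      by (rule continuous_on_cong[THEN iffD1, OF refl, rotated]) (use T(4) in simp)
    then show ?thesis
      using T(1,2) continuous_on_eq_continuous_at continuous_at_imp_continuous_at_within by blast
  qed
  then show ?case
    by (simp add: continuous_on_eq_continuous_within)
next
  case (Suc n f)
  have deriv: "(f has_derivative L) (at y)"
    if "open T" "y \<in> T" "linear L" "\<forall>y\<in>T. f y = L y + k" for T L k y
  proof -
    have "((\<lambda>y. L y + k) has_derivative L) (at y)"
      by (rule has_derivative_add_const[OF linear_imp_has_derivative[OF that(3)]])
    then show ?thesis
      by (rule has_derivative_transform_within_open[OF _ that(1,2)]) (use that(4) in simp)
  qed
  have "f differentiable (at x)" if "x \<in> S" for x
    using Suc.prems[OF that] deriv unfolding differentiable_def by blast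
  moreover have "Ck_on n (\<lambda>x. frechet_derivative f (at x) v) S" for v
  proof (rule Suc.IH)
    fix x assume "x \<in> S"
    then obtain T L k where T: "open T" "x \<in> T" "linear L" "\<forall>y\<in>T. f y = L y + k"
      using Suc.prems by blast
    then have "\<forall>y\<in>T. frechet_derivative f (at y) v = 0 + L v"
      using frechet_derivative_at[OF deriv[OF T(1) _ T(3,4)]] by (metis add_0)
    with T show "\<exists>T L k. open T \<and> x \<in> T \<and> linear L \<and>
        (\<forall>y\<in>T. frechet_derivative f (at y) v = L y + k)"
      by (intro exI[of _ T] exI[of _ "\<lambda>_. 0"] exI[of _ "L v"]) (simp add: linear_iff)
  qed
  ultimately show ?case by simp
qed

lemma smooth_on_const: "smooth_on (\<lambda>x. k) S"
  unfolding smooth_on_def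
  by (intro allI locally_affine_Ck_on exI[of _ UNIV] exI[of _ "\<lambda>_. 0"] exI[of _ k])
    (auto simp: linear_iff)

text \<open>Differentiation commutes with a constant \<open>J\<close>, so after expanding the
  brackets all terms cancel in pairs, whatever the square of \<open>J\<close> is.\<close>

lemma Nijenhuis_const:
  fixes J :: "'e::euclidean_space \<Rightarrow> 'e"
  assumes "linear J" and X: "X differentiable (at y)" and Y: "Y differentiable (at y)"
  shows "Nijenhuis (\<lambda>_. J) X Y y = 0"
proof -
  have "frechet_derivative (\<lambda>z. J (Z z)) (at y) v = J (frechet_derivative Z (at y) v)"
    if "Z differentiable (at y)" for Z v
  proof -
    have "((\<lambda>z. J (Z z)) has_derivative (\<lambda>v. J (frechet_derivative Z (at y) v))) (at y)"
      using that assms(1) frechet_derivative_works linear_linear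
      by (metis bounded_linear.has_derivative)
    then show ?thesis
      using frechet_derivative_at by metis
  qed
  note D = this[OF X] this[OF Y]
  show ?thesis
    unfolding Nijenhuis_def Lie_bracket_def D
    by (simp add: linear_diff[OF assms(1)])
qed

section \<open>Quotients by free proper actions of affine maps\<close>

text \<open>Affinity is required on \<open>E\<close> only, as group elements are extensional.
  Properness takes a common neighbourhood of two points, since a Hausdorff quotient needs distinct
  orbits to be separated.\<close>

locale affine_proper_action = group_action G E "\<lambda>f. f"
  for G :: "('e::euclidean_space \<Rightarrow> 'e) monoid" (structure) and E +
  assumes open_space: "open E"
    and affine: "g \<in> carrier G \<Longrightarrow> \<exists>L k. linear L \<and> (\<forall>x\<in>E. g x = L x + k)"
    and free: "\<lbrakk>g \<in> carrier G; x \<in> E; g x = x; y \<in> E\<rbrakk> \<Longrightarrow> g y = y"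
    and proper: "\<lbrakk>x \<in> E; y \<in> E\<rbrakk> \<Longrightarrow>
      \<exists>W. open W \<and> x \<in> W \<and> y \<in> W \<and> finite {g \<in> carrier G. \<exists>z\<in>W \<inter> E. g z \<in> W}"
begin

section \<open>Orbits and separation of points\<close>

lemma mem_space: "g \<in> carrier G \<Longrightarrow> x \<in> E \<Longrightarrow> g x \<in> E"
  using element_image by blast

lemma quot_proj_eq_iff:
  assumes "x \<in> E" "y \<in> E"
  shows "quot_proj G x = quot_proj G y \<longleftrightarrow> (\<exists>g\<in>carrier G. g x = y)"
proof
  assume "quot_proj G x = quot_proj G y"
  then have "y \<in> quot_proj G x"
    using orbit_refl[OF assms(2)] by simp
  then show "\<exists>g\<in>carrier G. g x = y"
    by (auto simp: orbit_def)
next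
  assume "\<exists>g\<in>carrier G. g x = y"
  then have y: "y \<in> quot_proj G x"
    by (auto simp: orbit_def)
  then have x: "x \<in> quot_proj G y"
    using orbit_sym assms by blast
  have sub: "quot_proj G u \<subseteq> E" if "u \<in> E" for u
    using that mem_space by (auto simp: orbit_def)
  show "quot_proj G x = quot_proj G y"
    using orbit_trans[OF assms(1) assms(2)] orbit_trans[OF assms(2) assms(1)] x y
      sub[OF assms(1)] sub[OF assms(2)] by blast
qed

lemma continuous_on_action:
  assumes "g \<in> carrier G"
  shows "continuous_on E g"
proof -
  obtain L k where L: "linear L" "\<forall>x\<in>E. g x = L x + k"
    using affine[OF assms] by blast
  have "continuous_on E (\<lambda>x. L x + k)"
    using L(1) by (intro continuous_on_add continuous_on_const linear_continuous_on)
      (simp add: linear_linear)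
  then show ?thesis
    by (rule continuous_on_cong[THEN iffD1, OF refl, rotated]) (use L(2) in simp)
qed

lemma open_vimage_action:
  assumes "g \<in> carrier G" "open U"
  shows "open {z \<in> E. g z \<in> U}"
proof -
  have "{z \<in> E. g z \<in> U} = E \<inter> g -` U"
    by auto
  then show ?thesis
    using continuous_open_preimage[OF continuous_on_action[OF assms(1)] open_space assms(2)] by simp
qed

text \<open>By properness only finitely many elements can spoil the conclusion, and each is excluded
  by separating \<open>g x\<close> from \<open>y\<close>. Distinct orbits give the Hausdorff
  property, and \<open>y = x\<close> gives neighbourhoods on which the projection is
  injective.\<close>

lemma separating_nhds:
  assumes "x \<in> E" "y \<in> E"
  obtains U V where "open U" "open V" "U \<subseteq> E" "V \<subseteq> E" "x \<in> U" "y \<in> V"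
    "\<And>g z. \<lbrakk>g \<in> carrier G; z \<in> U; g z \<in> V\<rbrakk> \<Longrightarrow> g x = y"
proof -
  obtain W where W: "open W" "x \<in> W" "y \<in> W" "finite {g \<in> carrier G. \<exists>z\<in>W \<inter> E. g z \<in> W}"
    using proper assms by blast
  \<comment> \<open>The elements to be excluded: they carry some point of \<open>W\<close> into
    \<open>W\<close> without carrying \<open>x\<close> to \<open>y\<close>.\<close>
  define F where "F = {g \<in> carrier G. (\<exists>z\<in>W \<inter> E. g z \<in> W) \<and> g x \<noteq> y}"
  have "finite F"
    by (rule finite_subset[OF _ W(4)]) (auto simp: F_def)
  have "\<forall>g\<in>F. \<exists>A B. open A \<and> open B \<and> g x \<in> A \<and> y \<in> B \<and> A \<inter> B = {}"
    by (intro ballI hausdorff) (simp add: F_def)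
  then obtain A B where AB: "\<And>g. g \<in> F \<Longrightarrow> open (A g) \<and> open (B g) \<and> g x \<in> A g \<and> y \<in> B g \<and> A g \<inter> B g = {}"
    by metis
  define U where "U = W \<inter> E \<inter> (\<Inter>g\<in>F. {z \<in> E. g z \<in> A g})"
  define V where "V = W \<inter> E \<inter> (\<Inter>g\<in>F. B g)"
  show ?thesis
  proof
    show "open U" "open V"
      unfolding U_def V_def using W(1) open_space \<open>finite F\<close> AB
      by (auto intro!: open_Int open_INT open_vimage_action simp: F_def)
    show "U \<subseteq> E" "V \<subseteq> E" "x \<in> U" "y \<in> V"
      using W AB assms by (auto simp: U_def V_def)
    fix g z assume g: "g \<in> carrier G" "z \<in> U" "g z \<in> V"
    show "g x = y"
    proof (rule ccontr)
      assume "g x \<noteq> y"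
      then have "g \<in> F"
        using g by (auto simp: F_def U_def V_def)
      then show False
        using g AB by (auto simp: U_def V_def)
    qed
  qed
qed

text \<open>An element relating two points of \<open>U \<inter> V\<close> must fix \<open>x\<close>,
  and by freeness it then fixes every point.\<close>

lemma injective_nhd:
  assumes "x \<in> E"
  obtains U where "open U" "U \<subseteq> E" "x \<in> U" "inj_on (quot_proj G) U"
proof -
  obtain U V where UV: "open U" "open V" "U \<subseteq> E" "V \<subseteq> E" "x \<in> U" "x \<in> V"
    "\<And>g z. \<lbrakk>g \<in> carrier G; z \<in> U; g z \<in> V\<rbrakk> \<Longrightarrow> g x = x"
    using separating_nhds[OF assms assms] by metis
  show ?thesis
  proof
    show "inj_on (quot_proj G) (U \<inter> V)"
    proof (rule inj_onI)
      fix z z' assume z: "z \<in> U \<inter> V" "z' \<in> U \<inter> V" "quot_proj G z = quot_proj G z'"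
      then have zE: "z \<in> E" "z' \<in> E"
        using UV(3) by auto
      then obtain g where g: "g \<in> carrier G" "g z = z'"
        using quot_proj_eq_iff[OF zE] z(3) by blast
      then have "g x = x"
        using UV(7)[OF g(1), of z] z g(2) by simp
      then show "z = z'"
        using free[OF g(1) assms _ zE(1)] g(2) by simp
    qed
  qed (use UV in auto)
qed

section \<open>The quotient topology\<close>

lemma openin_quot_topology_iff:
  "openin (quot_topology G E) W \<longleftrightarrow> W \<subseteq> quot_proj G ` E \<and> open {x \<in> E. quot_proj G x \<in> W}"
proof -
  have "openin (quot_topology G E) W \<longleftrightarrow> openin (top_of_set E) {x \<in> E. quot_proj G x \<in> W}"
    if "W \<subseteq> quot_proj G ` E"
    using that quotient_map_quot_topology[of E G] unfolding quotient_map_def by simp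
  moreover have "W \<subseteq> quot_proj G ` E" if "openin (quot_topology G E) W"
    using openin_subset[OF that] quotient_map_quot_topology[of E G] unfolding quotient_map_def
    by simp
  moreover have "openin (top_of_set E) {x \<in> E. quot_proj G x \<in> W} \<longleftrightarrow> open {x \<in> E. quot_proj G x \<in> W}"
    using openin_open_eq[OF open_space] by auto
  ultimately show ?thesis by blast
qed

lemma topspace_quot_topology: "topspace (quot_topology G E) = quot_proj G ` E"
  using quotient_map_quot_topology[of E G] unfolding quotient_map_def by simp

text \<open>The saturation of \<open>U\<close> is the union of its preimages under the group
  elements, all of which are open.\<close>

lemma openin_quot_proj_image:
  assumes "open U" "U \<subseteq> E"
  shows "openin (quot_topology G E) (quot_proj G ` U)"
proof -
  have "{x \<in> E. quot_proj G x \<in> quot_proj G ` U} = (\<Union>g\<in>carrier G. {x \<in> E. g x \<in> U})"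
  proof -
    have "quot_proj G x \<in> quot_proj G ` U \<longleftrightarrow> (\<exists>g\<in>carrier G. g x \<in> U)" if "x \<in> E" for x
      using quot_proj_eq_iff[OF that] assms(2) by (auto simp: image_iff) blast+
    then show ?thesis by blast
  qed
  then show ?thesis
    using assms open_vimage_action by (auto simp: openin_quot_topology_iff)
qed

lemma Hausdorff_quot_topology: "Hausdorff_space (quot_topology G E)"
  unfolding Hausdorff_space_def topspace_quot_topology
proof (intro allI impI, elim conjE imageE)
  fix P Q x y assume xy: "x \<in> E" "y \<in> E" "P = quot_proj G x" "Q = quot_proj G y" "P \<noteq> Q"
  obtain U V where UV: "open U" "open V" "U \<subseteq> E" "V \<subseteq> E" "x \<in> U" "y \<in> V"
    "\<And>g z. \<lbrakk>g \<in> carrier G; z \<in> U; g z \<in> V\<rbrakk> \<Longrightarrow> g x = y"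
    using separating_nhds[OF xy(1,2)] by metis
  have "disjnt (quot_proj G ` U) (quot_proj G ` V)"
  proof (rule ccontr)
    assume "\<not> ?thesis"
    then obtain u v where uv: "u \<in> U" "v \<in> V" "quot_proj G u = quot_proj G v"
      by (auto simp: disjnt_iff)
    then obtain g where "g \<in> carrier G" "g u = v"
      using quot_proj_eq_iff UV by blast
    then show False
      using UV(7) uv xy quot_proj_eq_iff by blast
  qed
  moreover have "openin (quot_topology G E) (quot_proj G ` U)" "openin (quot_topology G E) (quot_proj G ` V)"
    using openin_quot_proj_image UV(1-4) by simp_all
  moreover have "P \<in> quot_proj G ` U" "Q \<in> quot_proj G ` V"
    unfolding xy(3,4) using UV(5,6) by simp_all
  ultimately show "\<exists>U V. openin (quot_topology G E) U \<and> openin (quot_topology G E) V \<and>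
      P \<in> U \<and> Q \<in> V \<and> disjnt U V"
    by blast
qed

text \<open>The projection is open and continuous, so it carries a countable base of the space to a
  countable base of the quotient.\<close>

lemma second_countable_quot_topology: "second_countable (quot_topology G E)"
proof -
  obtain \<B> :: "'e set set" where \<B>: "countable \<B>" "\<And>C. C \<in> \<B> \<Longrightarrow> open C"
    "\<And>S. open S \<Longrightarrow> \<exists>U. U \<subseteq> \<B> \<and> S = \<Union>U"
    using univ_second_countable by metis
  let ?B = "(\<lambda>C. quot_proj G ` (C \<inter> E)) ` \<B>"
  have "\<exists>V\<in>?B. P \<in> V \<and> V \<subseteq> W" if W: "openin (quot_topology G E) W" "P \<in> W" for W P
  proof -
    obtain x where x: "x \<in> E" "P = quot_proj G x"
      using W openin_quot_topology_iff by blast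
    have "open {x \<in> E. quot_proj G x \<in> W}"
      using W openin_quot_topology_iff by blast
    then obtain U where "U \<subseteq> \<B>" "{x \<in> E. quot_proj G x \<in> W} = \<Union>U"
      using \<B>(3) by blast
    then obtain C where "C \<in> \<B>" "x \<in> C" "C \<subseteq> {x \<in> E. quot_proj G x \<in> W}"
      using x W by blast
    then show ?thesis
      using x by (intro bexI[of _ "quot_proj G ` (C \<inter> E)"]) auto
  qed
  moreover have "openin (quot_topology G E) V" if V: "V \<in> ?B" for V
  proof -
    obtain C where "C \<in> \<B>" "V = quot_proj G ` (C \<inter> E)"
      using V by blast
    then show ?thesis
      using openin_quot_proj_image[OF open_Int[OF \<B>(2) open_space]] by simp
  qed
  moreover have "countable ?B"
    using \<B>(1) by (rule countable_image)
  ultimately show ?thesis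
    unfolding second_countable_def by metis
qed

section \<open>Charts and transition maps\<close>

lemma quot_atlasE:
  assumes "c \<in> quot_atlas G E"
  obtains U where "open U" "U \<subseteq> E" "inj_on (quot_proj G) U"
    "c = (quot_proj G ` U, inv_into U (quot_proj G))" "chart_im c = U"
  using assms unfolding quot_atlas_def chart_im_def by fastforce

lemma chart_im_quot_atlas:
  assumes "c \<in> quot_atlas G E"
  shows "open (chart_im c)" "chart_im c \<subseteq> E"
  using assms by (auto elim: quot_atlasE)

lemma chart_map_mem:
  assumes "c \<in> quot_atlas G E" "P \<in> chart_dom c"
  shows "chart_map c P \<in> chart_im c" "quot_proj G (chart_map c P) = P"
  using assms by (auto elim!: quot_atlasE simp: inv_into_f_f)

lemma chart_map_quot_proj:
  assumes "c \<in> quot_atlas G E" "x \<in> chart_im c"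
  shows "quot_proj G x \<in> chart_dom c" "chart_map c (quot_proj G x) = x"
  using assms by (auto elim!: quot_atlasE simp: inv_into_f_f)

text \<open>On \<open>U\<close> the projection is continuous, open and injective, hence a
  homeomorphism onto its image, and the chart is its inverse.\<close>

lemma homeomorphic_map_chart:
  assumes "c \<in> quot_atlas G E"
  shows "homeomorphic_map (subtopology (quot_topology G E) (chart_dom c))
    (top_of_set (chart_im c)) (chart_map c)"
proof -
  obtain U where U: "open U" "U \<subseteq> E" "inj_on (quot_proj G) U"
    "c = (quot_proj G ` U, inv_into U (quot_proj G))" "chart_im c = U"
    using quot_atlasE[OF assms] .
  let ?X = "subtopology (quot_topology G E) (quot_proj G ` U)"
  have top: "topspace ?X = quot_proj G ` U"
    using U(2) by (auto simp: topspace_quot_topology)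
  have "homeomorphic_map (top_of_set U) ?X (quot_proj G)"
  proof (rule bijective_open_imp_homeomorphic_map)
    have "continuous_map (top_of_set E) (quot_topology G E) (quot_proj G)"
      using quotient_map_quot_topology quotient_imp_continuous_map by blast
    then have "continuous_map (top_of_set U) (quot_topology G E) (quot_proj G)"
      using U(2) continuous_map_from_subtopology_mono by blast
    then show "continuous_map (top_of_set U) ?X (quot_proj G)"
      by (auto simp: continuous_map_in_subtopology)
    show "open_map (top_of_set U) ?X (quot_proj G)"
      unfolding open_map_def
    proof (intro allI impI)
      fix S assume "openin (top_of_set U) S"
      then have S: "open S" "S \<subseteq> U"
        using openin_open_eq[OF U(1)] by auto
      then have "openin (quot_topology G E) (quot_proj G ` S)"
        using openin_quot_proj_image U(2) by blast
      moreover have "quot_proj G ` S = quot_proj G ` S \<inter> quot_proj G ` U"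
        using S by blast
      ultimately show "openin ?X (quot_proj G ` S)"
        by (auto simp: openin_subtopology)
    qed
  qed (use U top in auto)
  then obtain h where h: "homeomorphic_maps (top_of_set U) ?X (quot_proj G) h"
    using homeomorphic_map_maps by blast
  have "homeomorphic_map ?X (top_of_set U) h"
    using h homeomorphic_maps_map by blast
  moreover have "h P = inv_into U (quot_proj G) P" if "P \<in> topspace ?X" for P
    using that h U(3) unfolding homeomorphic_maps_def top by (auto simp: inv_into_f_f)
  ultimately have "homeomorphic_map ?X (top_of_set U) (inv_into U (quot_proj G))"
    by (rule homeomorphic_map_eq)
  then show ?thesis
    using U by simp
qed

text \<open>The element \<open>g\<close> preserves orbits and the chart \<open>d\<close> inverts the
  projection on its image. Hence the transition map agrees with \<open>g\<close> at every point of
  \<open>chart_im c\<close> that \<open>g\<close> carries into \<open>chart_im d\<close>, which is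
  an open condition.\<close>

lemma transition_locally_action:
  assumes c: "c \<in> quot_atlas G E" and d: "d \<in> quot_atlas G E"
    and P: "P \<in> chart_dom c" "P \<in> chart_dom d"
    and g: "g \<in> carrier G" "g (chart_map c P) = chart_map d P"
  obtains T where "open T" "chart_map c P \<in> T" "T \<subseteq> E" "\<And>y. y \<in> T \<Longrightarrow> transition c d y = g y"
proof
  let ?T = "chart_im c \<inter> {y \<in> E. g y \<in> chart_im d}"
  show "open ?T" "?T \<subseteq> E"
    using chart_im_quot_atlas(1)[OF c] chart_im_quot_atlas(1)[OF d]
    by (auto intro: open_Int open_vimage_action[OF g(1)])
  show "chart_map c P \<in> ?T"
    using chart_map_mem(1)[OF c P(1)] chart_map_mem(1)[OF d P(2)] g(2) chart_im_quot_atlas(2)[OF c]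
    by auto
  fix y assume y: "y \<in> ?T"
  have "inv_into (chart_dom c) (chart_map c) y = quot_proj G y"
  proof (rule inv_into_f_eq)
    show "inj_on (chart_map c) (chart_dom c)"
      by (rule inj_on_inverseI[of _ "quot_proj G"]) (rule chart_map_mem(2)[OF c])
  qed (use y chart_map_quot_proj[OF c] in auto)
  moreover have "quot_proj G y = quot_proj G (g y)"
    using y g(1) mem_space[OF g(1)] quot_proj_eq_iff[of y "g y"] by blast
  ultimately show "transition c d y = g y"
    using y chart_map_quot_proj[OF d] by (simp add: transition_def)
qed

lemma transition_exists_action:
  assumes c: "c \<in> quot_atlas G E" and d: "d \<in> quot_atlas G E"
    and P: "P \<in> chart_dom c" "P \<in> chart_dom d"
  obtains g where "g \<in> carrier G" "g (chart_map c P) = chart_map d P"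
proof -
  have "chart_map c P \<in> E" "chart_map d P \<in> E"
    using chart_map_mem(1) chart_im_quot_atlas(2) c d P by blast+
  then show ?thesis
    using that quot_proj_eq_iff[of "chart_map c P" "chart_map d P"]
      chart_map_mem(2)[OF c P(1)] chart_map_mem(2)[OF d P(2)] by auto
qed

text \<open>This reduces the transformation law of a tensor field to a condition on the linear parts
  of group elements.\<close>

lemma tangent_change_eq:
  assumes c: "c \<in> quot_atlas G E" and d: "d \<in> quot_atlas G E"
    and P: "P \<in> chart_dom c" "P \<in> chart_dom d"
    and g: "g \<in> carrier G" "g (chart_map c P) = chart_map d P"
    and L: "linear L" "\<And>x. x \<in> E \<Longrightarrow> g x = L x + k"
  shows "tangent_change c d P = L"
proof -
  obtain T where T: "open T" "chart_map c P \<in> T" "T \<subseteq> E" "\<And>y. y \<in> T \<Longrightarrow> transition c d y = g y"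
    using transition_locally_action[OF c d P g] by blast
  have "((\<lambda>y. L y + k) has_derivative L) (at (chart_map c P))"
    by (rule has_derivative_add_const[OF linear_imp_has_derivative[OF L(1)]])
  then have "(transition c d has_derivative L) (at (chart_map c P))"
    by (rule has_derivative_transform_within_open[OF _ T(1,2)]) (use T L(2) in auto)
  then show ?thesis
    unfolding tangent_change_def by (rule frechet_derivative_at[symmetric])
qed

theorem smooth_manifold_quot: "smooth_manifold (quot_topology G E) (quot_atlas G E)"
  unfolding smooth_manifold_def
proof (intro conjI ballI)
  show "topspace (quot_topology G E) = \<Union> (chart_dom ` quot_atlas G E)"
  proof
    show "topspace (quot_topology G E) \<subseteq> \<Union> (chart_dom ` quot_atlas G E)"
    proof
      fix P assume "P \<in> topspace (quot_topology G E)"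
      then obtain x where x: "x \<in> E" "P = quot_proj G x"
        by (auto simp: topspace_quot_topology)
      obtain U where "open U" "U \<subseteq> E" "x \<in> U" "inj_on (quot_proj G) U"
        using injective_nhd[OF x(1)] .
      then have "(quot_proj G ` U, inv_into U (quot_proj G)) \<in> quot_atlas G E" "P \<in> quot_proj G ` U"
        using x(2) unfolding quot_atlas_def by blast+
      then show "P \<in> \<Union> (chart_dom ` quot_atlas G E)"
        by force
    qed
  qed (force simp: topspace_quot_topology quot_atlas_def)
  fix c assume c: "c \<in> quot_atlas G E"
  show "openin (quot_topology G E) (chart_dom c)"
    using c by (auto elim!: quot_atlasE intro: openin_quot_proj_image)
  show "open (chart_im c)"
    using c chart_im_quot_atlas by blast
  show "homeomorphic_map (subtopology (quot_topology G E) (chart_dom c))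
    (top_of_set (chart_im c)) (chart_map c)"
    using c by (rule homeomorphic_map_chart)
  fix d assume d: "d \<in> quot_atlas G E"
  show "smooth_on (transition c d) (chart_map c ` (chart_dom c \<inter> chart_dom d))"
    unfolding smooth_on_def
  proof (intro allI locally_affine_Ck_on)
    fix n :: nat and y assume "y \<in> chart_map c ` (chart_dom c \<inter> chart_dom d)"
    then obtain P where P: "P \<in> chart_dom c" "P \<in> chart_dom d" "y = chart_map c P"
      by blast
    then obtain g where g: "g \<in> carrier G" "g (chart_map c P) = chart_map d P"
      using transition_exists_action[OF c d] by blast
    obtain T where T: "open T" "y \<in> T" "T \<subseteq> E" "\<And>y. y \<in> T \<Longrightarrow> transition c d y = g y"
      unfolding P(3) using transition_locally_action[OF c d P(1,2) g] by blast
    obtain L k where "linear L" "\<forall>x\<in>E. g x = L x + k"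
      using affine[OF g(1)] by blast
    with T show "\<exists>T L k. open T \<and> y \<in> T \<and> linear L \<and> (\<forall>x\<in>T. transition c d x = L x + k)"
      by (intro exI[of _ T] exI[of _ L] exI[of _ k]) auto
  qed
qed (simp_all add: Hausdorff_quot_topology second_countable_quot_topology)

section \<open>Constant endomorphisms on the quotient\<close>

text \<open>The differentials of the transition maps are linear parts of group elements, so
  commuting with the latter makes the constant components agree on overlaps.\<close>

lemma smooth_endomorphism_const:
  assumes "linear J"
    and comm: "\<And>g. g \<in> carrier G \<Longrightarrow>
      \<exists>L k. linear L \<and> (\<forall>x\<in>E. g x = L x + k) \<and> (\<forall>v. J (L v) = L (J v))"
  shows "smooth_endomorphism (quot_atlas G E) (\<lambda>_ _. J)"
  unfolding smooth_endomorphism_def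
proof (intro conjI ballI allI)
  fix c d P v assume cd: "c \<in> quot_atlas G E" "d \<in> quot_atlas G E"
    and "P \<in> chart_dom c \<inter> chart_dom d"
  then have P: "P \<in> chart_dom c" "P \<in> chart_dom d" by auto
  obtain g where g: "g \<in> carrier G" "g (chart_map c P) = chart_map d P"
    using transition_exists_action[OF cd P] .
  obtain L k where L: "linear L" "\<forall>x\<in>E. g x = L x + k" "\<forall>v. J (L v) = L (J v)"
    using comm[OF g(1)] by blast
  then have "tangent_change c d P = L"
    using tangent_change_eq[OF cd P g L(1)] by blast
  then show "J (tangent_change c d P v) = tangent_change c d P (J v)"
    using L(3) by simp
qed (use assms smooth_on_const in auto)

lemma integrable_endomorphism_const:
  assumes "linear J"
  shows "integrable_endomorphism (quot_atlas G E) (\<lambda>_ _. J)"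
  unfolding integrable_endomorphism_def
proof (intro ballI allI impI)
  fix c :: "('e set, 'e) chart" and X Y :: "'e \<Rightarrow> 'e" and y
  assume "smooth_on X (chart_im c)" "smooth_on Y (chart_im c)" and y: "y \<in> chart_im c"
  then have "Ck_on (Suc 0) X (chart_im c)" "Ck_on (Suc 0) Y (chart_im c)"
    unfolding smooth_on_def by blast+
  then have "X differentiable (at y)" "Y differentiable (at y)"
    using y by simp_all
  then show "Nijenhuis (\<lambda>_. J) X Y y = 0"
    using Nijenhuis_const[OF assms] by blast
qed

end

section \<open>The transformation group of an Inoue surface\<close>

text \<open>Shifting the translation part of \<open>w\<close> by \<open>x * y / 2\<close> makes the \<open>s\<close>-coordinate of a composition
  (\<open>amap_compose\<close>) twisted only by the symplectic form, so that \<open>s\<close> can be confined to a subgroup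
  \<open>\<delta>\<int>\<close>.\<close>

definition amap :: "real \<Rightarrow> real \<Rightarrow> real \<Rightarrow> real \<Rightarrow> real \<Rightarrow> complex \<times> complex \<Rightarrow> complex \<times> complex" where
  "amap t e x y s = (\<lambda>(z, w). (of_real t * z + of_real x,
     of_real e * w + of_real (y * t) * z + of_real (s + x * y / 2)))"

definition alin :: "real \<Rightarrow> real \<Rightarrow> real \<Rightarrow> complex \<times> complex \<Rightarrow> complex \<times> complex" where
  "alin t e y = (\<lambda>(z, w). (of_real t * z, of_real e * w + of_real (y * t) * z))"

lemma linear_alin: "linear (alin t e y)"
  by (rule linearI) (auto simp: alin_def complex_eq_iff algebra_simps)

lemma amap_eq_alin: "amap t e x y s v = alin t e y v + (of_real x, of_real (s + x * y / 2))"
  by (cases v) (simp add: amap_def alin_def)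

lemma amap_compose:
  assumes "t \<noteq> 0"
  shows "amap t e x y s (amap t' e' x' y' s' v) =
    amap (t * t') (e * e') (x + t * x') (y + e * y' / t)
      (s + e * s' + (t * x' * y - x * (e * y' / t)) / 2) v"
  using assms by (cases v) (simp add: amap_def complex_eq_iff field_simps)

lemma amap_id: "amap 1 1 0 0 0 v = v"
  by (cases v) (simp add: amap_def)

text \<open>The parameters solve the composition law for the identity. The symplectic term vanishes
  there, because the two translation vectors entering it are opposite.\<close>

lemma amap_inverse:
  assumes "t \<noteq> 0" "e * e = 1"
  shows "amap (inverse t) e (- x / t) (- e * t * y) (- e * s) (amap t e x y s v) = v"
    and "amap t e x y s (amap (inverse t) e (- x / t) (- e * t * y) (- e * s) v) = v"
proof -
  have e: "e = 1 \<or> e = - 1"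
    using assms(2) by (simp add: square_eq_1_iff)
  show "amap (inverse t) e (- x / t) (- e * t * y) (- e * s) (amap t e x y s v) = v"
    using e assms(1) by (cases v) (auto simp: amap_def complex_eq_iff field_simps)
  show "amap t e x y s (amap (inverse t) e (- x / t) (- e * t * y) (- e * s) v) = v"
    using e assms(1) by (cases v) (auto simp: amap_def complex_eq_iff field_simps)
qed

lemma amap_mem_space:
  assumes "t > 0" "v \<in> inoue_space"
  shows "amap t e x y s v \<in> inoue_space"
  using assms by (cases v) (simp add: amap_def inoue_space_def)

text \<open>The map scales \<open>Im z > 0\<close> by \<open>t\<close>, whence \<open>t = 1\<close>.
  If also \<open>e = 1\<close>, the imaginary part of the second component forces
  \<open>y = 0\<close>, and the real part then \<open>s = 0\<close>.\<close>

lemma amap_fixed_point: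
  assumes "amap t e x y s v = v" "v \<in> inoue_space"
  shows "t = 1" and "e = 1 \<Longrightarrow> x = 0 \<and> y = 0 \<and> s = 0"
proof -
  obtain z w where v: "v = (z, w)" "Im z > 0"
    using assms(2) by (cases v) (auto simp: inoue_space_def)
  have eqs: "t * Im z = Im z" "t * Re z + x = Re z" "e * Im w + y * t * Im z = Im w"
    "e * Re w + y * t * Re z + (s + x * y / 2) = Re w"
    using assms(1) by (simp_all add: amap_def v complex_eq_iff)
  then show t: "t = 1"
    using v by simp
  assume "e = 1"
  with eqs t have "x = 0" "y * Im z = 0" "y * Re z + (s + x * y / 2) = 0"
    by simp_all
  then show "x = 0 \<and> y = 0 \<and> s = 0"
    using v by simp
qed

section \<open>The space, finiteness of parameters and estimates on boxes\<close>

lemma open_inoue_space: "open inoue_space"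
  unfolding inoue_space_def by (intro open_Times open_halfspace_Im_gt open_UNIV)

lemma convex_inoue_space: "convex inoue_space"
  unfolding inoue_space_def by (intro convex_Times convex_halfspace_Im_gt convex_UNIV)

lemma minus_one_powi: "(-1::real) powi n = of_int (if even n then 1 else - 1)"
  by (simp add: power_int_minus_left)

lemma finite_int_abs_le: "finite {m::int. \<bar>real_of_int m\<bar> \<le> B}"
proof (rule finite_subset)
  show "{m::int. \<bar>real_of_int m\<bar> \<le> B} \<subseteq> {- \<lceil>B\<rceil>..\<lceil>B\<rceil>}"
    by (auto simp: abs_le_iff) linarith+
qed simp

lemma finite_powi_between:
  assumes "(\<alpha>::real) > 1" "C > 0"
  shows "finite {n::int. 1 / C < \<alpha> powi n \<and> \<alpha> powi n < C}"
proof -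
  obtain M where M: "C < \<alpha> ^ M"
    using real_arch_pow assms(1) by blast
  have "- int M \<le> n \<and> n \<le> int M" if n: "1 / C < \<alpha> powi n" "\<alpha> powi n < C" for n
  proof (rule ccontr)
    assume "\<not> ?thesis"
    then consider "n \<le> - int M" | "int M \<le> n" by linarith
    then show False
    proof cases
      case 1
      then have "\<alpha> powi n \<le> \<alpha> powi (- int M)"
        using assms(1) by (intro power_int_increasing) auto
      also have "\<dots> = 1 / \<alpha> ^ M"
        by (simp add: power_int_minus divide_inverse)
      also have "\<dots> < 1 / C"
        using M assms by (intro divide_strict_left_mono) auto
      finally show False
        using n by simp
    next
      case 2
      then have "\<alpha> powi int M \<le> \<alpha> powi n"
        using assms(1) by (intro power_int_increasing) auto
      then show False
        using n M by simp
    qed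
  qed
  then have "{n. 1 / C < \<alpha> powi n \<and> \<alpha> powi n < C} \<subseteq> {- int M..int M}"
    by auto
  then show ?thesis
    using finite_subset by blast
qed

text \<open>Relatively compact open sets that exhaust the space as \<open>R\<close> grows; the bound
  \<open>1 / R\<close> keeps them away from the boundary of the half-plane.\<close>

definition inoue_box :: "real \<Rightarrow> (complex \<times> complex) set" where
  "inoue_box R = {v. 1 / R < Im (fst v) \<and> Im (fst v) < R \<and> \<bar>Re (fst v)\<bar> < R \<and>
     \<bar>Re (snd v)\<bar> < R \<and> \<bar>Im (snd v)\<bar> < R}"

lemma open_inoue_box: "open (inoue_box R)"
  unfolding inoue_box_def by (intro open_Collect_conj open_Collect_less continuous_intros)

lemma inoue_box_exhausts:
  assumes "u \<in> inoue_space" "v \<in> inoue_space"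
  obtains R where "R > 1" "u \<in> inoue_box R" "v \<in> inoue_box R"
proof -
  \<comment> \<open>A single quantity dominating every coordinate bound, so that any
    \<open>R\<close> above it is admissible.\<close>
  define f where "f u = 1 / Im (fst u) + Im (fst u) + \<bar>Re (fst u)\<bar> + \<bar>Re (snd u)\<bar> + \<bar>Im (snd u)\<bar>"
    for u :: "complex \<times> complex"
  have pos: "Im (fst u) > 0" "Im (fst v) > 0"
    using assms by (auto simp: inoue_space_def)
  have box: "x \<in> inoue_box R" if "f x < R" "Im (fst x) > 0" for R x
  proof -
    have i: "1 / Im (fst x) > 0"
      using that by simp
    have "1 / Im (fst x) < R" "R > 0"
      using that i unfolding f_def by linarith+
    then have "1 / R < Im (fst x)"
      using that by (simp add: field_simps)
    moreover have "Im (fst x) < R" "\<bar>Re (fst x)\<bar> < R" "\<bar>Re (snd x)\<bar> < R" "\<bar>Im (snd x)\<bar> < R"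
      using that i unfolding f_def by linarith+
    ultimately show ?thesis
      unfolding inoue_box_def by simp
  qed
  have f: "f u \<ge> 0" "f v \<ge> 0"
    using pos by (auto simp: f_def)
  show ?thesis
    by (rule that[of "2 + f u + f v"]) (use f pos in \<open>auto intro!: box\<close>)
qed

text \<open>The parameters are bounded one after the other: \<open>t\<close> by the ratio of the
  imaginary parts of first components, \<open>x\<close> by the real parts, \<open>y\<close> by the
  imaginary parts of second components together with \<open>Im z' > 1 / R\<close>, and finally
  \<open>s\<close> by the remaining real part.\<close>

lemma amap_box_bounds:
  assumes R: "R > 1" and v: "v \<in> inoue_box R" "amap t e x y s v \<in> inoue_box R"
    and e: "\<bar>e\<bar> = 1"
  shows "1 / R\<^sup>2 < t" "t < R\<^sup>2" "\<bar>x\<bar> \<le> R + R ^ 3" "\<bar>y\<bar> \<le> 2 * R\<^sup>2"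
    "\<bar>s\<bar> \<le> 2 * R + 2 * R ^ 5 + (R + R ^ 3) * R\<^sup>2"
proof -
  obtain z w where zw: "v = (z, w)" by (cases v)
  define z' w' where "z' = of_real t * z + complex_of_real x"
    and "w' = of_real e * w + of_real (y * t) * z + complex_of_real (s + x * y / 2)"
  have b: "1 / R < Im z" "Im z < R" "\<bar>Re z\<bar> < R" "\<bar>Re w\<bar> < R" "\<bar>Im w\<bar> < R"
    "1 / R < Im z'" "Im z' < R" "\<bar>Re z'\<bar> < R" "\<bar>Re w'\<bar> < R" "\<bar>Im w'\<bar> < R"
    using v unfolding zw inoue_box_def amap_def z'_def w'_def by simp_all
  have eqs: "Im z' = t * Im z" "Re z' = t * Re z + x"
    "Re w' = e * Re w + y * t * Re z + s + x * y / 2" "Im w' = e * Im w + y * (t * Im z)"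
    by (simp_all add: z'_def w'_def)
  have R0: "1 / R > 0" "R > 0"
    using R by simp_all
  have Iz: "Im z > 0" "Im z' > 0"
    using b R0 by linarith+
  have "t = Im z' / Im z"
    using eqs(1) Iz by simp
  then have t0: "t > 0"
    using Iz by simp
  have "t * (1 / R) < t * Im z"
    using b(1) t0 by (intro mult_strict_left_mono)
  also have "\<dots> < R"
    using eqs b by simp
  finally show tR: "t < R\<^sup>2"
    using R by (simp add: field_simps power2_eq_square)
  have "1 / R < t * Im z"
    using eqs b by simp
  also have "\<dots> < t * R"
    using b t0 by (intro mult_strict_left_mono)
  finally show "1 / R\<^sup>2 < t"
    using R by (simp add: field_simps power2_eq_square)
  have tRe: "\<bar>t * Re z\<bar> \<le> R ^ 3"
  proof -
    have "\<bar>t * Re z\<bar> = t * \<bar>Re z\<bar>"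
      using t0 by (simp add: abs_mult)
    also have "\<dots> \<le> R\<^sup>2 * R"
      using tR b t0 by (intro mult_mono) auto
    finally show ?thesis
      by (simp add: power2_eq_square power3_eq_cube)
  qed
  have "\<bar>x\<bar> \<le> \<bar>Re z'\<bar> + \<bar>t * Re z\<bar>"
    unfolding eqs by linarith
  then show xb: "\<bar>x\<bar> \<le> R + R ^ 3"
    using tRe b by linarith
  have eb: "\<bar>e * Re w\<bar> < R" "\<bar>e * Im w\<bar> < R"
    using b e by (simp_all add: abs_mult)
  have "\<bar>y\<bar> * (1 / R) \<le> \<bar>y\<bar> * Im z'"
    using b by (intro mult_left_mono) auto
  also have "\<dots> = \<bar>y * Im z'\<bar>"
    using Iz(2) by (simp add: abs_mult)
  also have "y * Im z' = Im w' - e * Im w"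
    unfolding eqs by simp
  also have "\<bar>Im w' - e * Im w\<bar> \<le> 2 * R"
    using eb(2) b(10) by linarith
  finally show yb: "\<bar>y\<bar> \<le> 2 * R\<^sup>2"
    using R by (simp add: field_simps power2_eq_square)
  have "\<bar>y * (t * Re z)\<bar> \<le> 2 * R\<^sup>2 * R ^ 3"
    unfolding abs_mult[of y] using yb tRe R by (intro mult_mono) auto
  then have ytb: "\<bar>y * t * Re z\<bar> \<le> 2 * R ^ 5"
    by (simp add: mult.assoc flip: power_add)
  have "\<bar>x * y\<bar> \<le> (R + R ^ 3) * (2 * R\<^sup>2)"
    unfolding abs_mult using xb yb R by (intro mult_mono) auto
  then have xyb: "\<bar>x * y / 2\<bar> \<le> (R + R ^ 3) * R\<^sup>2"
    by (simp only: abs_divide)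
  have "s = Re w' - e * Re w - y * t * Re z - x * y / 2"
    using eqs by simp
  moreover have "\<bar>u1 - u2 - u3 - u4\<bar> \<le> 2 * R + B3 + B4"
    if "\<bar>u1\<bar> < R" "\<bar>u2\<bar> < R" "\<bar>u3\<bar> \<le> B3" "\<bar>u4\<bar> \<le> B4" for u1 u2 u3 u4 B3 B4
    using that by linarith
  ultimately show "\<bar>s\<bar> \<le> 2 * R + 2 * R ^ 5 + (R + R ^ 3) * R\<^sup>2"
    using eb(1) b(9) ytb xyb by blast
qed

locale inoue_surface =
  fixes p q r :: int and N :: "int^2^2" and \<alpha> A :: real and a b c :: "real^2"
  assumes r: "r \<noteq> 0"
    and det_N: "det N = -1"
    and \<alpha>: "\<alpha> > 1"
    and a: "a \<noteq> 0" "(\<chi> i j. real_of_int (N$i$j)) *v a = \<alpha> *\<^sub>R a"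
    and b: "b \<noteq> 0" "(\<chi> i j. real_of_int (N$i$j)) *v b = (- 1 / \<alpha>) *\<^sub>R b"
    and A: "A = inoue_A r a b"
    and c: "\<And>i. - c$i = real_of_int (N$i$1) * c$1 + real_of_int (N$i$2) * c$2
                   + inoue_e N a b $ i + A * real_of_int ((vector [p, q] :: int^2) $ i)"
begin

section \<open>The matrix and its eigenvectors\<close>

lemma det_N_eq: "N$1$1 * N$2$2 - N$1$2 * N$2$1 = -1"
  using det_N by (simp add: det_2)

lemma eigen_a:
  "real_of_int (N$1$1) * a$1 + real_of_int (N$1$2) * a$2 = \<alpha> * a$1"
  "real_of_int (N$2$1) * a$1 + real_of_int (N$2$2) * a$2 = \<alpha> * a$2"
  using a(2) by (auto simp: vec_eq_iff matrix_vector_mult_def sum_2 forall_2)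

lemma eigen_b:
  "real_of_int (N$1$1) * b$1 + real_of_int (N$1$2) * b$2 = - b$1 / \<alpha>"
  "real_of_int (N$2$1) * b$1 + real_of_int (N$2$2) * b$2 = - b$2 / \<alpha>"
  using b(2) by (auto simp: vec_eq_iff matrix_vector_mult_def sum_2 forall_2)

lemma det_N_real: "real_of_int (N$1$1) * real_of_int (N$2$2) - real_of_int (N$1$2) * real_of_int (N$2$1) = -1"
proof -
  have "real_of_int (N$1$1 * N$2$2 - N$1$2 * N$2$1) = real_of_int (-1)"
    by (simp only: det_N_eq)
  then show ?thesis by simp
qed

text \<open>The coefficients are the entries of the inverse of \<open>N\<close>, which is minus the
  adjugate and therefore integral, because the determinant is \<open>-1\<close>.\<close>

lemma eigen_inverse_a:
  "a$1 / \<alpha> = - real_of_int (N$2$2) * a$1 + real_of_int (N$1$2) * a$2"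
  "a$2 / \<alpha> = real_of_int (N$2$1) * a$1 - real_of_int (N$1$1) * a$2"
proof -
  have "\<alpha> * (- real_of_int (N$2$2) * a$1 + real_of_int (N$1$2) * a$2) = a$1"
    using eigen_a det_N_real by algebra
  then show "a$1 / \<alpha> = - real_of_int (N$2$2) * a$1 + real_of_int (N$1$2) * a$2"
    using \<alpha> by (simp add: field_simps)
  have "\<alpha> * (real_of_int (N$2$1) * a$1 - real_of_int (N$1$1) * a$2) = a$2"
    using eigen_a det_N_real by algebra
  then show "a$2 / \<alpha> = real_of_int (N$2$1) * a$1 - real_of_int (N$1$1) * a$2"
    using \<alpha> by (simp add: field_simps)
qed

lemma eigen_inverse_b:
  "- \<alpha> * b$1 = - real_of_int (N$2$2) * b$1 + real_of_int (N$1$2) * b$2"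
  "- \<alpha> * b$2 = real_of_int (N$2$1) * b$1 - real_of_int (N$1$1) * b$2"
proof -
  have "\<alpha> * (real_of_int (N$1$1) * b$1 + real_of_int (N$1$2) * b$2) = - b$1"
    "\<alpha> * (real_of_int (N$2$1) * b$1 + real_of_int (N$2$2) * b$2) = - b$2"
    using eigen_b \<alpha> by simp_all
  then show "- \<alpha> * b$1 = - real_of_int (N$2$2) * b$1 + real_of_int (N$1$2) * b$2"
    "- \<alpha> * b$2 = real_of_int (N$2$1) * b$1 - real_of_int (N$1$1) * b$2"
    using det_N_real by algebra+
qed

lemma eigenvectors_independent: "a$1 * b$2 - a$2 * b$1 \<noteq> 0"
proof
  assume d: "a$1 * b$2 - a$2 * b$1 = 0"
  have e: "\<alpha> * (real_of_int (N$1$1) * b$1 + real_of_int (N$1$2) * b$2) = - b$1"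
    "\<alpha> * (real_of_int (N$2$1) * b$1 + real_of_int (N$2$2) * b$2) = - b$2"
    using eigen_b \<alpha> by simp_all
  \<comment> \<open>The factor is \<alpha> times the difference of the eigenvalues \<alpha> and
    -1/\<alpha>; its being nonzero expresses that they are distinct.\<close>
  have "(\<alpha>\<^sup>2 + 1) * (a$1 * b$1) = 0" "(\<alpha>\<^sup>2 + 1) * (a$2 * b$2) = 0"
    using d e eigen_a by algebra+
  moreover have "\<alpha>\<^sup>2 + 1 \<noteq> 0"
    using \<alpha> by (smt (verit) zero_le_power2)
  ultimately have "a$1 * b$1 = 0" "a$2 * b$2 = 0"
    by auto
  moreover have "a$1 \<noteq> 0 \<or> a$2 \<noteq> 0" "b$1 \<noteq> 0 \<or> b$2 \<noteq> 0"
    using a(1) b(1) by (auto simp: vec_eq_iff forall_2)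
  ultimately show False
    using d by auto
qed

text \<open>Since \<open>det N = -1\<close>, this trace is also \<open>det (1 + N)\<close>, the denominator arising when the equation for \<open>c\<close>
  is solved.\<close>

definition tr :: int where "tr = N$1$1 + N$2$2"

text \<open>By Cayley-Hamilton, trace 0 and determinant -1 would make \<open>N\<close> an
  involution, so that the square of \<alpha> would be 1.\<close>

lemma tr_nonzero: "tr \<noteq> 0"
proof
  assume "tr = 0"
  then have "real_of_int (N$1$1) + real_of_int (N$2$2) = 0"
    unfolding tr_def by (metis of_int_0 of_int_add)
  then have "(\<alpha>\<^sup>2 - 1) * a$1 = 0" "(\<alpha>\<^sup>2 - 1) * a$2 = 0"
    using eigen_a det_N_real by algebra+
  moreover have "\<alpha>\<^sup>2 - 1 \<noteq> 0"
    using \<alpha> by (smt (verit) one_less_power pos2)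
  ultimately have "a$1 = 0" "a$2 = 0"
    by auto
  then show False
    using a(1) by (auto simp: vec_eq_iff forall_2)
qed

text \<open>The generator of the discrete group that contains all \<open>s\<close>-coordinates:
  \<open>tr\<close> clears the denominator in the solution for \<open>c\<close>, and the 2 absorbs
  the halves in the equation for \<open>c\<close> and in the symplectic term.\<close>

definition \<delta> :: real where "\<delta> = A / (2 * tr)"

lemma A_eq: "A = real_of_int (2 * tr) * \<delta>"
  using tr_nonzero by (simp add: \<delta>_def)

lemma r_A: "r * A = b$1 * a$2 - b$2 * a$1"
  using r by (simp add: A inoue_A_def)

lemma \<delta>_nonzero: "\<delta> \<noteq> 0"
proof -
  have "r * A \<noteq> 0"
    using eigenvectors_independent unfolding r_A by (simp add: algebra_simps)
  then show ?thesis
    using A_eq by auto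
qed

section \<open>The lattice of translations and the translation parts\<close>

text \<open>Both coordinates share the integers \<open>m\<close> and \<open>n\<close>. The pairs
  form a discrete set by \<open>eigenvectors_independent\<close>, although the values of one
  coordinate alone need not.\<close>

definition lat :: "real \<Rightarrow> real \<Rightarrow> bool" where
  "lat x y \<longleftrightarrow> (\<exists>(m::int) (n::int). x = m * a$1 + n * a$2 \<and> y = m * b$1 + n * b$2)"

lemma latI: "x = real_of_int m * a$1 + real_of_int n * a$2 \<Longrightarrow>
    y = real_of_int m * b$1 + real_of_int n * b$2 \<Longrightarrow> lat x y"
  unfolding lat_def by blast

lemma lat_0: "lat 0 0"
  by (rule latI[of _ 0 0]) auto

lemma lat_gen: "lat (a$1) (b$1)" "lat (a$2) (b$2)"
  by (rule latI[of _ 1 0]; simp) (rule latI[of _ 0 1]; simp)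

lemma lat_add:
  assumes "lat x y" "lat x' y'"
  shows "lat (x + x') (y + y')"
proof -
  obtain m n m' n' :: int where "x = m * a$1 + n * a$2" "y = m * b$1 + n * b$2"
    "x' = m' * a$1 + n' * a$2" "y' = m' * b$1 + n' * b$2"
    using assms unfolding lat_def by blast
  then show ?thesis
    by (intro latI[of _ "m + m'" "n + n'"]) (simp_all add: algebra_simps)
qed

lemma lat_minus: "lat x y \<Longrightarrow> lat (- x) (- y)"
proof -
  assume "lat x y"
  then obtain m n :: int where "x = m * a$1 + n * a$2" "y = m * b$1 + n * b$2"
    unfolding lat_def by blast
  then show ?thesis
    by (intro latI[of _ "- m" "- n"]) (simp_all add: algebra_simps)
qed

text \<open>The diagonal map with entries \<alpha> and -1/\<alpha> acts on the coefficient row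
  \<open>(m, n)\<close> as right multiplication by \<open>N\<close>; its inverse acts through the
  integral inverse of \<open>N\<close>.\<close>

lemma lat_step: "lat x y \<Longrightarrow> lat (\<alpha> * x) (- y / \<alpha>)"
proof -
  assume "lat x y"
  then obtain m n :: int where mn: "x = m * a$1 + n * a$2" "y = m * b$1 + n * b$2"
    unfolding lat_def by blast
  have "\<alpha> * x = m * (\<alpha> * a$1) + n * (\<alpha> * a$2)" "- y / \<alpha> = m * (- b$1 / \<alpha>) + n * (- b$2 / \<alpha>)"
    using \<alpha> by (simp_all add: mn field_simps)
  then show ?thesis
    unfolding eigen_a[symmetric] eigen_b[symmetric]
    by (intro latI[of _ "m * N$1$1 + n * N$2$1" "m * N$1$2 + n * N$2$2"]) (simp_all add: algebra_simps)
qed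

lemma lat_step_inverse: "lat x y \<Longrightarrow> lat (x / \<alpha>) (- \<alpha> * y)"
proof -
  assume "lat x y"
  then obtain m n :: int where mn: "x = m * a$1 + n * a$2" "y = m * b$1 + n * b$2"
    unfolding lat_def by blast
  have "x / \<alpha> = m * (a$1 / \<alpha>) + n * (a$2 / \<alpha>)" "- \<alpha> * y = m * (- \<alpha> * b$1) + n * (- \<alpha> * b$2)"
    using \<alpha> by (simp_all add: mn field_simps)
  then show ?thesis
    unfolding eigen_inverse_a eigen_inverse_b
    by (intro latI[of _ "- m * N$2$2 + n * N$2$1" "m * N$1$2 - n * N$1$1"]) (simp_all add: algebra_simps)
qed

text \<open>This is the effect on the lattice of conjugation by powers of
  \<open>inoue_phi0 \<alpha>\<close>, in the form in which it enters the composition law.\<close>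

lemma lat_powi: "lat x y \<Longrightarrow> lat (\<alpha> powi n * x) ((-1) powi n * y / \<alpha> powi n)"
proof (induction n rule: int_induct[where k = 0])
  case base
  then show ?case by simp
next
  case (step1 i)
  have "lat (\<alpha> * (\<alpha> powi i * x)) (- ((-1) powi i * y / \<alpha> powi i) / \<alpha>)"
    using lat_step step1 by blast
  then show ?case
    using \<alpha> by (simp add: power_int_add_1 mult_ac)
next
  case (step2 i)
  have "lat (\<alpha> powi i * x / \<alpha>) (- \<alpha> * ((-1) powi i * y / \<alpha> powi i))"
    using lat_step_inverse step2 by blast
  then show ?case
    using \<alpha> by (simp add: power_int_diff mult_ac)
qed

text \<open>The form is an integral determinant times its value on the basis, which is
  \<open>r * A\<close> up to sign, and \<open>A / 2\<close> is \<open>tr * \<delta>\<close>.\<close>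

lemma lat_symplectic:
  assumes "lat x y" "lat x' y'"
  obtains k :: int where "(x' * y - x * y') / 2 = k * \<delta>"
proof -
  obtain m n m' n' :: int where *: "x = m * a$1 + n * a$2" "y = m * b$1 + n * b$2"
    "x' = m' * a$1 + n' * a$2" "y' = m' * b$1 + n' * b$2"
    using assms unfolding lat_def by blast
  have "(x' * y - x * y') = (real_of_int m * n' - real_of_int n * m') * (b$1 * a$2 - b$2 * a$1)"
    unfolding * by (simp add: algebra_simps)
  also have "\<dots> = (real_of_int m * n' - real_of_int n * m') * (r * A)"
    by (simp only: r_A)
  finally have "(x' * y - x * y') / 2 = (real_of_int m * n' - real_of_int n * m') * r * (A / 2)"
    by simp
  also have "A / 2 = real_of_int tr * \<delta>"
    using tr_nonzero by (simp add: \<delta>_def)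
  finally have "(x' * y - x * y') / 2 = real_of_int ((m * n' - n * m') * r * tr) * \<delta>"
    by simp
  then show ?thesis by (rule that)
qed

text \<open>After subtracting \<open>a$i * b$i / 2\<close>, the equation for \<open>c\<close>
  becomes \<open>2 * (1 + N) \<gamma> = - A * \<nu>\<close> with an integral vector
  \<open>\<nu>\<close>: the quadratic terms cancel and the mixed term contributes
  \<open>r * A\<close>. Cramer's rule then divides by \<open>2 * tr\<close>.\<close>

lemma translation_part: "\<exists>k::int. c$i - a$i * b$i / 2 = k * \<delta>"
proof -
  define \<gamma> where "\<gamma> i = c$i - a$i * b$i / 2" for i
  define \<nu> where "\<nu> i = N$i$1 * N$i$2 * r + 2 * (vector [p, q] :: int^2)$i" for i
  \<comment> \<open>The product of the two eigenvalues is -1; this identity removes the terms of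
    \<open>inoue_e\<close> that are quadratic in \<open>N\<close>.\<close>
  have ab: "(real_of_int (N$i$1) * a$1 + real_of_int (N$i$2) * a$2) *
      (real_of_int (N$i$1) * b$1 + real_of_int (N$i$2) * b$2) = - a$i * b$i" for i
  proof -
    have "(\<alpha> * u) * (- v / \<alpha>) = - u * v" for u v
      using \<alpha> by simp
    moreover have "i = 1 \<or> i = 2" using exhaust_2 by blast
    ultimately show ?thesis
      by (elim disjE) (simp_all only: eigen_a eigen_b)
  qed
  have \<gamma>: "2 * (\<gamma> i + (real_of_int (N$i$1) * \<gamma> 1 + real_of_int (N$i$2) * \<gamma> 2)) = - A * \<nu> i" for i
  proof -
    have "- 2 * c$i = 2 * real_of_int (N$i$1) * c$1 + 2 * real_of_int (N$i$2) * c$2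
      + real_of_int (N$i$1) * (real_of_int (N$i$1) - 1) * a$1 * b$1
      + real_of_int (N$i$2) * (real_of_int (N$i$2) - 1) * a$2 * b$2
      + 2 * real_of_int (N$i$1) * real_of_int (N$i$2) * b$1 * a$2
      + 2 * A * real_of_int ((vector [p, q] :: int^2) $ i)"
      using c[of i] by (simp add: inoue_e_def field_simps)
    moreover have "A * \<nu> i = real_of_int (N$i$1) * real_of_int (N$i$2) * (r * A)
        + 2 * A * real_of_int ((vector [p, q] :: int^2) $ i)"
      by (simp add: \<nu>_def algebra_simps)
    ultimately have "2 * c$i - a$i * b$i + real_of_int (N$i$1) * (2 * c$1 - a$1 * b$1)
        + real_of_int (N$i$2) * (2 * c$2 - a$2 * b$2) = - A * \<nu> i"
      using ab[of i] r_A by algebra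
    then show ?thesis
      unfolding \<gamma>_def by (simp add: algebra_simps)
  qed
  have D: "real_of_int tr = real_of_int (N$1$1) + real_of_int (N$2$2)"
    by (simp add: tr_def)
  \<comment> \<open>Multiplication by the adjugate of \<open>1 + N\<close>, whose determinant is
    \<open>tr\<close>.\<close>
  have "2 * real_of_int tr * \<gamma> 1 = - A * ((1 + real_of_int (N$2$2)) * \<nu> 1 - real_of_int (N$1$2) * \<nu> 2)"
    "2 * real_of_int tr * \<gamma> 2 = - A * ((1 + real_of_int (N$1$1)) * \<nu> 2 - real_of_int (N$2$1) * \<nu> 1)"
    unfolding D using \<gamma>[of 1] \<gamma>[of 2] det_N_real by algebra+
  then have "\<gamma> 1 = real_of_int (- ((1 + N$2$2) * \<nu> 1 - N$1$2 * \<nu> 2)) * \<delta>"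
    "\<gamma> 2 = real_of_int (- ((1 + N$1$1) * \<nu> 2 - N$2$1 * \<nu> 1)) * \<delta>"
    using tr_nonzero unfolding \<delta>_def by (simp_all add: field_simps)
  then show ?thesis
    using exhaust_2[of i] unfolding \<gamma>_def by blast
qed

text \<open>A group which may be strictly larger than \<open>\<Gamma>\<close>, but is described explicitly and still acts
  properly.\<close>

definition overgroup :: "(complex \<times> complex \<Rightarrow> complex \<times> complex) set" where
  "overgroup = {restrict (amap (\<alpha> powi n) ((-1) powi n) x y (of_int k * \<delta>)) inoue_space
     | n x y k. lat x y}"

lemma overgroupI:
  "\<lbrakk>t = \<alpha> powi n; e = (-1) powi n; lat x y; s = of_int k * \<delta>\<rbrakk> \<Longrightarrow>
    restrict (amap t e x y s) inoue_space \<in> overgroup"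
  unfolding overgroup_def by blast

text \<open>In the composition law, \<open>lat_powi\<close> keeps the translation vector in the
  lattice, and \<open>lat_symplectic\<close> makes the twist of \<open>s\<close> a multiple of
  \<delta>; the sign \<open>e\<close> preserves such multiples.\<close>

lemma overgroup_mult:
  assumes "f \<in> overgroup" "g \<in> overgroup"
  shows "compose inoue_space f g \<in> overgroup"
proof -
  obtain n x y k where f: "lat x y"
    "f = restrict (amap (\<alpha> powi n) ((-1) powi n) x y (of_int k * \<delta>)) inoue_space"
    using assms(1) unfolding overgroup_def by blast
  obtain n' x' y' k' where g: "lat x' y'"
    "g = restrict (amap (\<alpha> powi n') ((-1) powi n') x' y' (of_int k' * \<delta>)) inoue_space"
    using assms(2) unfolding overgroup_def by blast
  let ?t = "\<alpha> powi n" and ?e = "(-1) powi n :: real"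
  have t: "?t > 0" "\<alpha> powi n' > 0"
    using \<alpha> by simp_all
  from t(1) have ne: "?t \<noteq> 0" by linarith
  have l: "lat (?t * x') (?e * y' / ?t)"
    using lat_powi g by blast
  obtain j :: int where j: "(?t * x' * y - x * (?e * y' / ?t)) / 2 = j * \<delta>"
    using lat_symplectic[OF f(1) l] by blast
  have "compose inoue_space f g = restrict (amap (?t * \<alpha> powi n') (?e * (-1) powi n') (x + ?t * x')
      (y + ?e * y' / ?t) (of_int k * \<delta> + ?e * (of_int k' * \<delta>) + j * \<delta>)) inoue_space"
    unfolding compose_def f(2) g(2)
    by (rule restrict_ext) (use t in \<open>simp only: restrict_apply' amap_mem_space amap_compose[OF ne] j\<close>)
  also have "\<dots> \<in> overgroup"
  proof (rule overgroupI)
    show "?t * \<alpha> powi n' = \<alpha> powi (n + n')" "?e * (-1) powi n' = (-1) powi (n + n')"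
      using \<alpha> by (simp_all add: power_int_add)
    show "lat (x + ?t * x') (y + ?e * y' / ?t)"
      using lat_add f(1) l by blast
    show "of_int k * \<delta> + ?e * (of_int k' * \<delta>) + j * \<delta> =
        of_int (k + (if even n then 1 else - 1) * k' + j) * \<delta>"
      unfolding minus_one_powi by (simp add: algebra_simps)
  qed
  finally show ?thesis .
qed

text \<open>The pointwise form yields both the bijectivity of the elements and, afterwards, their
  inverses in \<open>BijGroup\<close>.\<close>

lemma overgroup_inverse:
  assumes "f \<in> overgroup"
  obtains g where "g \<in> overgroup" "\<And>v. v \<in> inoue_space \<Longrightarrow> g v \<in> inoue_space"
    "\<And>v. v \<in> inoue_space \<Longrightarrow> f v \<in> inoue_space"
    "\<And>v. v \<in> inoue_space \<Longrightarrow> g (f v) = v" "\<And>v. v \<in> inoue_space \<Longrightarrow> f (g v) = v"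
proof -
  obtain n x y k where f: "lat x y"
    "f = restrict (amap (\<alpha> powi n) ((-1) powi n) x y (of_int k * \<delta>)) inoue_space"
    using assms(1) unfolding overgroup_def by blast
  let ?t = "\<alpha> powi n" and ?e = "(-1) powi n :: real"
  have t: "?t > 0" "inverse ?t > 0"
    using \<alpha> by simp_all
  have e: "?e * ?e = 1"
    by (simp add: minus_one_powi)
  let ?g = "amap (inverse ?t) ?e (- x / ?t) (- ?e * ?t * y) (- ?e * (of_int k * \<delta>))"
  have einv: "(-1) powi (- n) = ?e"
    by (simp add: minus_one_powi)
  \<comment> \<open>These are the translation parameters of \<open>amap_inverse\<close>, since the
    sign \<open>e\<close> is its own inverse.\<close>
  have "lat (\<alpha> powi (- n) * (- x)) ((-1) powi (- n) * (- y) / \<alpha> powi (- n))"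
    by (intro lat_powi lat_minus f)
  then have l: "lat (- x / ?t) (- ?e * ?t * y)"
    unfolding einv by (simp add: power_int_minus divide_inverse mult_ac)
  have k: "- ?e * (of_int k * \<delta>) = of_int ((if even n then - 1 else 1) * k) * \<delta>"
    by (simp add: minus_one_powi)
  have "restrict ?g inoue_space \<in> overgroup"
    by (rule overgroupI[OF power_int_minus[symmetric] einv[symmetric] l k])
  moreover have ne: "?t \<noteq> 0"
    using t(1) by linarith
  ultimately show ?thesis
    using t amap_inverse[OF ne e]
    by (intro that[of "restrict ?g inoue_space"]) (simp_all only: f(2) restrict_apply' amap_mem_space)
qed

lemma overgroup_Bij: "overgroup \<subseteq> Bij inoue_space"
proof
  fix f assume f: "f \<in> overgroup"
  then obtain g where "\<And>v. v \<in> inoue_space \<Longrightarrow> g v \<in> inoue_space"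
    "\<And>v. v \<in> inoue_space \<Longrightarrow> f v \<in> inoue_space"
    "\<And>v. v \<in> inoue_space \<Longrightarrow> g (f v) = v" "\<And>v. v \<in> inoue_space \<Longrightarrow> f (g v) = v"
    using overgroup_inverse by metis
  then have "bij_betw f inoue_space inoue_space"
    by (intro bij_betw_byWitness[where f' = g]) auto
  moreover have "f \<in> extensional inoue_space"
    using f unfolding overgroup_def by auto
  ultimately show "f \<in> Bij inoue_space"
    by (simp add: Bij_def)
qed

lemma subgroup_overgroup: "subgroup overgroup (BijGroup inoue_space)"
proof (rule group.subgroupI[OF group_BijGroup])
  show "overgroup \<subseteq> carrier (BijGroup inoue_space)"
    using overgroup_Bij by (simp add: BijGroup_def)
  have "restrict (amap 1 1 0 0 0) inoue_space \<in> overgroup"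
    by (rule overgroupI[of _ 0 _ _ _ _ 0]) (simp_all add: lat_0)
  then show "overgroup \<noteq> {}" by blast
  fix f assume f: "f \<in> overgroup"
  obtain g where g: "g \<in> overgroup" "\<And>v. v \<in> inoue_space \<Longrightarrow> g (f v) = v"
    using overgroup_inverse[OF f] by metis
  have "g \<otimes>\<^bsub>BijGroup inoue_space\<^esub> f = \<one>\<^bsub>BijGroup inoue_space\<^esub>"
    using f g overgroup_Bij by (auto simp: BijGroup_def compose_def)
  then have "inv\<^bsub>BijGroup inoue_space\<^esub> f = g"
    using f g overgroup_Bij
    by (intro group.inv_equality[OF group_BijGroup]) (auto simp: BijGroup_def)
  then show "inv\<^bsub>BijGroup inoue_space\<^esub> f \<in> overgroup"
    using g by simp
  fix h assume h: "h \<in> overgroup"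
  show "f \<otimes>\<^bsub>BijGroup inoue_space\<^esub> h \<in> overgroup"
    using overgroup_mult[OF f h] f h overgroup_Bij by (auto simp: BijGroup_def)
qed

text \<open>The generator \<open>inoue_phi0\<close> has exponent 1 and no translation, the
  \<open>inoue_phi\<close> have exponent 0 and \<open>s\<close>-coordinate
  \<open>c$i - a$i * b$i / 2\<close>, and \<open>inoue_phi3\<close> has \<open>s = A\<close>, which
  is \<open>2 * tr\<close> times \<delta>.\<close>

lemma generators_overgroup:
  "{inoue_phi0 \<alpha>, inoue_phi a b c 1, inoue_phi a b c 2, inoue_phi3 A} \<subseteq> overgroup"
proof -
  have "inoue_phi0 \<alpha> = restrict (amap \<alpha> (-1) 0 0 0) inoue_space"
    unfolding inoue_phi0_def by (rule restrict_ext) (auto simp: amap_def)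
  then have "inoue_phi0 \<alpha> \<in> overgroup"
    using overgroupI[of \<alpha> 1 "-1" 0 0 0 0] lat_0 by simp
  moreover have "inoue_phi a b c i \<in> overgroup" for i
  proof -
    obtain k :: int where k: "c$i - a$i * b$i / 2 = k * \<delta>"
      using translation_part by blast
    have "inoue_phi a b c i = restrict (amap 1 1 (a$i) (b$i) (c$i - a$i * b$i / 2)) inoue_space"
      unfolding inoue_phi_def by (rule restrict_ext) (auto simp: amap_def)
    moreover have "lat (a$i) (b$i)"
      using lat_gen exhaust_2[of i] by auto
    ultimately show ?thesis
      using overgroupI[of 1 0 1 "a$i" "b$i" _ k] k by simp
  qed
  moreover have "inoue_phi3 A = restrict (amap 1 1 0 0 A) inoue_space"
    unfolding inoue_phi3_def by (rule restrict_ext) (auto simp: amap_def)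
  then have "inoue_phi3 A \<in> overgroup"
    using overgroupI[OF _ _ lat_0 A_eq, of 1 0 1] by simp
  ultimately show ?thesis by blast
qed

section \<open>The Inoue group and its free and proper action\<close>

abbreviation \<Gamma> where "\<Gamma> \<equiv> inoue_group \<alpha> a b c A"

lemma subgroup_\<Gamma>: "subgroup (carrier \<Gamma>) (BijGroup inoue_space)"
proof -
  have "{inoue_phi0 \<alpha>, inoue_phi a b c 1, inoue_phi a b c 2, inoue_phi3 A} \<subseteq>
      carrier (BijGroup inoue_space)"
    using generators_overgroup subgroup.subset[OF subgroup_overgroup] by (rule subset_trans)
  from group.generate_is_subgroup[OF group_BijGroup this] show ?thesis
    by (simp add: inoue_group_def)
qed

lemma carrier_\<Gamma>_subset: "carrier \<Gamma> \<subseteq> overgroup"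
  unfolding inoue_group_def
  using group.generate_subgroup_incl[OF group_BijGroup generators_overgroup subgroup_overgroup] by simp

lemma phi0_in_\<Gamma>: "inoue_phi0 \<alpha> \<in> carrier \<Gamma>"
  unfolding inoue_group_def by (simp add: generate.incl)

lemma \<Gamma>_amapE:
  assumes "g \<in> carrier \<Gamma>"
  obtains n x y k where "lat x y"
    "g = restrict (amap (\<alpha> powi n) ((-1) powi n) x y (of_int k * \<delta>)) inoue_space"
  using assms carrier_\<Gamma>_subset unfolding overgroup_def by blast

lemma group_action_\<Gamma>: "group_action \<Gamma> inoue_space (\<lambda>f. f)"
proof -
  have eq: "\<Gamma> = BijGroup inoue_space \<lparr>carrier := carrier \<Gamma>\<rparr>"
    by (simp add: inoue_group_def)
  have "group \<Gamma>"
    using subgroup.subgroup_is_group[OF subgroup_\<Gamma> group_BijGroup] eq by simp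
  moreover have "(\<lambda>f. f) \<in> hom \<Gamma> (BijGroup inoue_space)"
    using subgroup.subset[OF subgroup_\<Gamma>] by (auto simp: hom_def inoue_group_def)
  ultimately show ?thesis
    unfolding group_action_def group_hom_def group_hom_axioms_def using group_BijGroup by blast
qed

text \<open>The linear part is kept in the form \<open>alin\<close>, whose real entries make it
  commute with the three endomorphisms.\<close>

lemma \<Gamma>_affine:
  assumes "g \<in> carrier \<Gamma>"
  shows "\<exists>t e y k. \<forall>v\<in>inoue_space. g v = alin t e y v + k"
proof -
  obtain n x y k where "g = restrict (amap (\<alpha> powi n) ((-1) powi n) x y (of_int k * \<delta>)) inoue_space"
    using \<Gamma>_amapE[OF assms] by metis
  then have "\<forall>v\<in>inoue_space. g v = alin (\<alpha> powi n) ((-1) powi n) y v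
      + (of_real x, of_real (of_int k * \<delta> + x * y / 2))"
    by (intro ballI) (simp only: restrict_apply' amap_eq_alin)
  then show ?thesis by blast
qed

text \<open>A fixed point forces \<open>\<alpha> powi n = 1\<close>, so \<open>n = 0\<close>; then
  the sign is 1 as well and all other parameters vanish.\<close>

lemma \<Gamma>_free:
  assumes "g \<in> carrier \<Gamma>" "v \<in> inoue_space" "g v = v" "u \<in> inoue_space"
  shows "g u = u"
proof -
  obtain n x y k where g: "lat x y"
    "g = restrict (amap (\<alpha> powi n) ((-1) powi n) x y (of_int k * \<delta>)) inoue_space"
    using \<Gamma>_amapE[OF assms(1)] .
  have eq: "amap (\<alpha> powi n) ((-1) powi n) x y (of_int k * \<delta>) v = v"
    using assms(2,3) g by simp
  have "n = 0"
  proof (rule ccontr)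
    assume "n \<noteq> 0"
    then consider "n < 0" | "0 < n" by linarith
    then have "\<alpha> powi n \<noteq> \<alpha> powi 0"
      using power_int_strict_increasing[OF _ \<alpha>, of n 0] power_int_strict_increasing[OF _ \<alpha>, of 0 n]
      by cases auto
    then show False
      using amap_fixed_point(1)[OF eq assms(2)] by simp
  qed
  moreover from this have "x = 0 \<and> y = 0 \<and> of_int k * \<delta> = 0"
    using amap_fixed_point(2)[OF eq assms(2)] by simp
  ultimately show ?thesis
    using assms(4) by (auto simp: g(2) amap_id)
qed

text \<open>The bounds of \<open>amap_box_bounds\<close> leave finitely many integers:
  \<open>n\<close> because \<alpha> > 1, the lattice coefficients because the eigenvectors are
  independent, and \<open>k\<close> because \<delta> is nonzero.\<close>

lemma \<Gamma>_proper:
  assumes "R > 1"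
  shows "finite {g \<in> carrier \<Gamma>. \<exists>v\<in>inoue_box R \<inter> inoue_space. g v \<in> inoue_box R}"
proof -
  define d where "d = a$1 * b$2 - a$2 * b$1"
  define X Y S where "X = R + R ^ 3" and "Y = 2 * R\<^sup>2"
    and "S = 2 * R + 2 * R ^ 5 + (R + R ^ 3) * R\<^sup>2"
  define f where "f = (\<lambda>(n, m, m', k). restrict (amap (\<alpha> powi n) ((-1) powi n)
    (of_int m * a$1 + of_int m' * a$2) (of_int m * b$1 + of_int m' * b$2) (of_int k * \<delta>)) inoue_space)"
  define T1 :: "int set" where "T1 = {n. 1 / R\<^sup>2 < \<alpha> powi n \<and> \<alpha> powi n < R\<^sup>2}"
  define T2 :: "int set" where "T2 = {m. \<bar>real_of_int m\<bar> \<le> (X * \<bar>b$2\<bar> + Y * \<bar>a$2\<bar>) / \<bar>d\<bar>}"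
  define T3 :: "int set" where "T3 = {m. \<bar>real_of_int m\<bar> \<le> (X * \<bar>b$1\<bar> + Y * \<bar>a$1\<bar>) / \<bar>d\<bar>}"
  define T4 :: "int set" where "T4 = {k. \<bar>real_of_int k\<bar> \<le> S / \<bar>\<delta>\<bar>}"
  have d: "d \<noteq> 0"
    using eigenvectors_independent by (simp add: d_def)
  have "finite (T1 \<times> T2 \<times> T3 \<times> T4)"
    unfolding T1_def T2_def T3_def T4_def using assms \<alpha>
    by (intro finite_cartesian_product finite_int_abs_le finite_powi_between) auto
  moreover have "{g \<in> carrier \<Gamma>. \<exists>v\<in>inoue_box R \<inter> inoue_space. g v \<in> inoue_box R} \<subseteq> f ` (T1 \<times> T2 \<times> T3 \<times> T4)"
  proof
    fix g assume "g \<in> {g \<in> carrier \<Gamma>. \<exists>v\<in>inoue_box R \<inter> inoue_space. g v \<in> inoue_box R}"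
    then obtain v where v: "g \<in> carrier \<Gamma>" "v \<in> inoue_box R" "v \<in> inoue_space" "g v \<in> inoue_box R"
      by blast
    obtain n x y k where g: "lat x y"
      "g = restrict (amap (\<alpha> powi n) ((-1) powi n) x y (of_int k * \<delta>)) inoue_space"
      using \<Gamma>_amapE[OF v(1)] .
    obtain m m' :: int where m: "x = m * a$1 + m' * a$2" "y = m * b$1 + m' * b$2"
      using g(1) unfolding lat_def by blast
    have e: "\<bar>(-1) powi n :: real\<bar> = 1"
      by (simp add: minus_one_powi)
    have box: "amap (\<alpha> powi n) ((-1) powi n) x y (of_int k * \<delta>) v \<in> inoue_box R"
      using v g by simp
    have B: "1 / R\<^sup>2 < \<alpha> powi n" "\<alpha> powi n < R\<^sup>2" "\<bar>x\<bar> \<le> X" "\<bar>y\<bar> \<le> Y" "\<bar>of_int k * \<delta>\<bar> \<le> S"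
      unfolding X_def Y_def S_def by (rule amap_box_bounds[OF assms v(2) box e])+
    have bound: "\<bar>x * s - y * s'\<bar> \<le> X * \<bar>s\<bar> + Y * \<bar>s'\<bar>" for s s'
    proof -
      have "\<bar>x * s - y * s'\<bar> \<le> \<bar>x\<bar> * \<bar>s\<bar> + \<bar>y\<bar> * \<bar>s'\<bar>"
        by (metis abs_mult abs_triangle_ineq4)
      also have "\<dots> \<le> X * \<bar>s\<bar> + Y * \<bar>s'\<bar>"
        using B by (intro add_mono mult_right_mono) auto
      finally show ?thesis .
    qed
    \<comment> \<open>Cramer's rule recovers the lattice coefficients from the bounded pair
      \<open>(x, y)\<close>.\<close>
    have "real_of_int m * d = x * b$2 - y * a$2" "- real_of_int m' * d = x * b$1 - y * a$1"
      unfolding m d_def by (simp_all add: algebra_simps)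
    then have "\<bar>real_of_int m * d\<bar> \<le> X * \<bar>b$2\<bar> + Y * \<bar>a$2\<bar>"
      "\<bar>- real_of_int m' * d\<bar> \<le> X * \<bar>b$1\<bar> + Y * \<bar>a$1\<bar>"
      using bound by metis+
    then have "m \<in> T2" "m' \<in> T3"
      using d by (simp_all add: T2_def T3_def abs_mult pos_le_divide_eq)
    moreover have "k \<in> T4"
      using B(5) \<delta>_nonzero by (simp add: T4_def abs_mult pos_le_divide_eq)
    moreover have "n \<in> T1"
      using B by (simp add: T1_def)
    moreover have "g = f (n, m, m', k)"
      by (simp add: f_def g(2) m)
    ultimately show "g \<in> f ` (T1 \<times> T2 \<times> T3 \<times> T4)"
      by blast
  qed
  ultimately show ?thesis
    using finite_surj by blast
qed

lemma affine_proper_action_\<Gamma>: "affine_proper_action \<Gamma> inoue_space"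
proof (intro affine_proper_action.intro affine_proper_action_axioms.intro)
  show "group_action \<Gamma> inoue_space (\<lambda>f. f)" by (rule group_action_\<Gamma>)
  show "open inoue_space" by (rule open_inoue_space)
  show "\<exists>L k. linear L \<and> (\<forall>x\<in>inoue_space. g x = L x + k)" if "g \<in> carrier \<Gamma>" for g
    using \<Gamma>_affine[OF that] linear_alin by blast
  show "g y = y" if "g \<in> carrier \<Gamma>" "x \<in> inoue_space" "g x = x" "y \<in> inoue_space" for g x y
    using \<Gamma>_free that by blast
  show "\<exists>W. open W \<and> x \<in> W \<and> y \<in> W \<and>
      finite {g \<in> carrier \<Gamma>. \<exists>z\<in>W \<inter> inoue_space. g z \<in> W}"
    if xy: "x \<in> inoue_space" "y \<in> inoue_space" for x y
  proof -
    obtain R where "R > 1" "x \<in> inoue_box R" "y \<in> inoue_box R"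
      using inoue_box_exhausts[OF xy] .
    then show ?thesis
      using open_inoue_box \<Gamma>_proper[of R] by (intro exI[of _ "inoue_box R"]) simp
  qed
qed

end

section \<open>The para-hypercomplex structure\<close>

context affine_proper_action
begin

text \<open>Lifted to \<open>E\<close>, a metric is invariant under the group. Taking
  \<open>f\<close> to be the identity compares two charts at one point, other elements compare
  different points of an orbit.\<close>

lemma metric_invariance:
  assumes m: "pseudo_Riemannian_metric (quot_atlas G E) m"
    and c: "c \<in> quot_atlas G E" and d: "d \<in> quot_atlas G E"
    and x: "x \<in> chart_im c" and f: "f \<in> carrier G" "f x \<in> chart_im d"
    and L: "linear L" "\<And>x. x \<in> E \<Longrightarrow> f x = L x + k"
  shows "m d (f x) (L u) (L v) = m c x u v"
proof -
  let ?P = "quot_proj G x"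
  have E: "x \<in> E" "f x \<in> E"
    using chart_im_quot_atlas(2) c d x f(2) by blast+
  have P: "?P = quot_proj G (f x)"
    using quot_proj_eq_iff[OF E] f(1) by blast
  have c': "?P \<in> chart_dom c" "chart_map c ?P = x"
    using chart_map_quot_proj[OF c x] by auto
  have d': "?P \<in> chart_dom d" "chart_map d ?P = f x"
    using chart_map_quot_proj[OF d f(2)] P by auto
  have "tangent_change c d ?P = L"
    by (rule tangent_change_eq[OF c d c'(1) d'(1) f(1) _ L]) (simp_all add: c' d')
  moreover have "m d (chart_map d ?P) (tangent_change c d ?P u) (tangent_change c d ?P v)
      = m c (chart_map c ?P) u v"
    using m c d c'(1) d'(1) unfolding pseudo_Riemannian_metric_def by blast
  ultimately show ?thesis
    by (simp add: c' d')
qed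

end

section \<open>The three endomorphisms and forms compatible with them\<close>

definition "para_J1 = (\<lambda>(z, w). (\<i> * z, \<i> * w))"
definition "para_J2 = (\<lambda>(z, w). (cnj z, cnj w))"
definition "para_J3 = (\<lambda>(z, w). (\<i> * cnj z, \<i> * cnj w))"

lemma linear_para:
  "linear para_J1" "linear para_J2" "linear para_J3"
  by (rule linearI; auto simp: para_J1_def para_J2_def para_J3_def algebra_simps)+

lemma para_alin:
  "para_J1 (alin t e y v) = alin t e y (para_J1 v)"
  "para_J2 (alin t e y v) = alin t e y (para_J2 v)"
  "para_J3 (alin t e y v) = alin t e y (para_J3 v)"
  by (cases v; simp add: para_J1_def para_J2_def para_J3_def alin_def algebra_simps)+

text \<open>A form compatible with the structure is determined by this one value.\<close>

lemma compatible_form_nonzero: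
  fixes B :: "complex \<times> complex \<Rightarrow> complex \<times> complex \<Rightarrow> real"
  assumes B: "bilinear B" and sym: "\<And>u v. B u v = B v u"
    and nondeg: "\<And>u. (\<And>v. B u v = 0) \<Longrightarrow> u = 0"
    and J1: "\<And>u v. B (para_J1 u) (para_J1 v) = B u v"
    and J2: "\<And>u v. - B (para_J2 u) (para_J2 v) = B u v"
  shows "B (1, 0) (0, \<i>) \<noteq> 0"
proof
  assume 14: "B (1, 0) (0, \<i>) = 0"
  \<comment> \<open>Conjugation fixes \<open>(1, 0)\<close> and \<open>(0, 1)\<close> but reverses
    the sign of \<open>B\<close>.\<close>
  have J2': "- B (1, 0) (1, 0) = B (1, 0) (1, 0)" "- B (1, 0) (0, 1) = B (1, 0) (0, 1)"
    using J2[of "(1, 0)" "(1, 0)"] J2[of "(1, 0)" "(0, 1)"] by (simp_all add: para_J2_def)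
  then have 11: "B (1, 0) (1, 0) = 0" and 13: "B (1, 0) (0, 1) = 0"
    by linarith+
  \<comment> \<open>Multiplication by \<open>\<i>\<close> swaps these two vectors up to one sign, so
    by symmetry the product equals its own negative.\<close>
  have "B (1, 0) (\<i>, 0) = B (\<i>, 0) (- (1, 0))"
    using J1[of "(1, 0)" "(\<i>, 0)"] by (simp add: para_J1_def)
  also have "\<dots> = - B (1, 0) (\<i>, 0)"
    unfolding bilinear_rneg[OF B] sym[of "(\<i>, 0)"] ..
  finally have 12: "B (1, 0) (\<i>, 0) = 0"
    by linarith
  have "B (1, 0) v = 0" for v
  proof -
    obtain z w where "v = (z, w)" by (cases v)
    then have "v = Re z *\<^sub>R (1, 0) + Im z *\<^sub>R (\<i>, 0) + Re w *\<^sub>R (0, 1) + Im w *\<^sub>R (0, \<i>)"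
      by (simp add: complex_eq_iff)
    then show ?thesis
      by (simp only: bilinear_radd[OF B] bilinear_rmul[OF B] 11 12 13 14) simp
  qed
  from nondeg[OF this] show False by (simp add: zero_prod_def)
qed

section \<open>The obstruction to a compatible metric and the structure on the surface\<close>

context inoue_surface
begin

interpretation affine_proper_action \<Gamma> inoue_space
  by (rule affine_proper_action_\<Gamma>)

lemma no_compatible_metric:
  "\<not> compatible_metric (quot_atlas \<Gamma> inoue_space) (\<lambda>_ _. para_J1) (\<lambda>_ _. para_J2) (\<lambda>_ _. para_J3) m"
proof
  let ?A = "quot_atlas \<Gamma> inoue_space"
  assume "compatible_metric ?A (\<lambda>_ _. para_J1) (\<lambda>_ _. para_J2) (\<lambda>_ _. para_J3) m"
  then have m: "pseudo_Riemannian_metric ?A m"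
    and comp: "\<And>c y u v. \<lbrakk>c \<in> ?A; y \<in> chart_im c\<rbrakk> \<Longrightarrow>
      m c y (para_J1 u) (para_J1 v) = m c y u v \<and> - m c y (para_J2 u) (para_J2 v) = m c y u v"
    unfolding compatible_metric_def by blast+
  define h where "h c y = m c y (1, 0) (0, \<i>)" for c y
  have h_nonzero: "h c y \<noteq> 0" if "c \<in> ?A" "y \<in> chart_im c" for c y
    unfolding h_def
  proof (rule compatible_form_nonzero)
    show "bilinear (m c y)" "m c y u v = m c y v u" for u v
      using m that unfolding pseudo_Riemannian_metric_def by blast+
    show "u = 0" if "\<And>v. m c y u v = 0" for u
      using m \<open>c \<in> ?A\<close> \<open>y \<in> chart_im c\<close> that unfolding pseudo_Riemannian_metric_def by blast
  qed (use comp that in blast)+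
  \<comment> \<open>Independence of the chart makes the sign of \<open>h\<close> a well-defined
    function on the space.\<close>
  have h_cong: "h d y = h c y" if cd: "c \<in> ?A" "d \<in> ?A" "y \<in> chart_im c" "y \<in> chart_im d" for c d y
  proof -
    have y: "y \<in> inoue_space"
      using cd chart_im_quot_atlas(2) by blast
    \<comment> \<open>The identity is restricted because the elements of the group are
      extensional.\<close>
    let ?i = "\<lambda>x\<in>inoue_space. x"
    have "?i = \<one>\<^bsub>\<Gamma>\<^esub>"
      by (rule id_eq_one)
    then have "?i \<in> carrier \<Gamma>"
      using group.is_monoid group_hom group_hom.axioms(1) monoid.one_closed by metis
    from metric_invariance[OF m cd(1,2,3) this _ linear_id, of 0 "(1, 0)" "(0, \<i>)"]
    show ?thesis
      using y cd(4) by (simp add: h_def)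
  qed
  have h_phi0: "\<alpha> * h d (inoue_phi0 \<alpha> y) = - h c y"
    if cd: "c \<in> ?A" "d \<in> ?A" "y \<in> chart_im c" "inoue_phi0 \<alpha> y \<in> chart_im d" for c d y
  proof -
    have "inoue_phi0 \<alpha> x = alin \<alpha> (-1) 0 x + 0" if "x \<in> inoue_space" for x
      using that by (cases x) (simp add: inoue_phi0_def alin_def)
    then have "m d (inoue_phi0 \<alpha> y) (alin \<alpha> (-1) 0 (1, 0)) (alin \<alpha> (-1) 0 (0, \<i>)) = h c y"
      unfolding h_def using metric_invariance[OF m cd(1,2,3) phi0_in_\<Gamma> cd(4) linear_alin] by blast
    moreover have "alin \<alpha> (-1) 0 (1, 0) = \<alpha> *\<^sub>R (1, 0)" "alin \<alpha> (-1) 0 (0, \<i>) = - (0, \<i>)"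
      by (simp_all add: alin_def complex_eq_iff)
    moreover have B: "bilinear (m d (inoue_phi0 \<alpha> y))"
      using m cd(2,4) unfolding pseudo_Riemannian_metric_def by blast
    ultimately show ?thesis
      by (simp only: h_def bilinear_lmul[OF B] bilinear_rneg[OF B]) simp
  qed
  \<comment> \<open>For \<open>s = 1\<close> and \<open>s = -1\<close> these are the sets where
    \<open>h\<close> is positive and negative. They are open, disjoint and cover the connected
    space, so one of them must be empty.\<close>
  define S where "S s = {y. \<exists>c\<in>?A. y \<in> chart_im c \<and> s * h c y > 0}" for s :: real
  have S_sub: "S s \<subseteq> inoue_space" for s
    unfolding S_def using chart_im_quot_atlas(2) by blast
  have open_S: "open (S s)" for s
  proof -
    have "open {y \<in> chart_im c. s * h c y > 0}" if c: "c \<in> ?A" for c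
    proof -
      have "smooth_on (\<lambda>y. m c y (1, 0) (0, \<i>)) (chart_im c)"
        using m c unfolding pseudo_Riemannian_metric_def by blast
      then have "Ck_on 0 (h c) (chart_im c)"
        unfolding smooth_on_def h_def by blast
      then have "continuous_on (chart_im c) (\<lambda>y. s * h c y)"
        by (simp add: continuous_on_mult_left)
      from continuous_open_preimage[OF this chart_im_quot_atlas(1)[OF c] open_greaterThan[of 0]]
      show ?thesis
        by (simp add: vimage_def Int_def)
    qed
    moreover have "S s = (\<Union>c\<in>?A. {y \<in> chart_im c. s * h c y > 0})"
      unfolding S_def by blast
    ultimately show ?thesis
      by auto
  qed
  have chart: "\<exists>c\<in>?A. y \<in> chart_im c" if y: "y \<in> inoue_space" for y
  proof -
    obtain U where U: "open U" "U \<subseteq> inoue_space" "y \<in> U" "inj_on (quot_proj \<Gamma>) U"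
      using injective_nhd[OF y] .
    let ?c = "(quot_proj \<Gamma> ` U, inv_into U (quot_proj \<Gamma>))"
    have "?c \<in> ?A"
      unfolding quot_atlas_def using U by blast
    moreover have "y \<in> chart_im ?c"
      unfolding chart_im_def using U by (simp add: inv_into_image_cancel)
    ultimately show ?thesis by blast
  qed
  have cover: "inoue_space \<subseteq> S 1 \<union> S (-1)"
  proof
    fix y assume "y \<in> inoue_space"
    then obtain c where c: "c \<in> ?A" "y \<in> chart_im c"
      using chart by blast
    then have "1 * h c y > 0 \<or> -1 * h c y > 0"
      using h_nonzero[OF c] by linarith
    then show "y \<in> S 1 \<union> S (-1)"
      using c unfolding S_def by blast
  qed
  have disjoint: "S 1 \<inter> S (-1) \<inter> inoue_space = {}"
  proof -
    have False if "y \<in> S 1" "y \<in> S (-1)" for y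
    proof -
      obtain c d where "c \<in> ?A" "y \<in> chart_im c" "1 * h c y > 0"
        "d \<in> ?A" "y \<in> chart_im d" "-1 * h d y > 0"
        using \<open>y \<in> S 1\<close> \<open>y \<in> S (-1)\<close> unfolding S_def by blast
      then show False
        using h_cong[of c d y] by simp
    qed
    then show ?thesis by blast
  qed
  \<comment> \<open>As \<alpha> > 0, the sign reversal exchanges the two sets; one being nonempty
    makes both nonempty, which contradicts connectedness.\<close>
  have swap: "inoue_phi0 \<alpha> y \<in> S (- s)" if y: "y \<in> S s" for y s
  proof -
    obtain c where c: "c \<in> ?A" "y \<in> chart_im c" "s * h c y > 0"
      using y unfolding S_def by blast
    have "inoue_phi0 \<alpha> y \<in> inoue_space"
      using mem_space[OF phi0_in_\<Gamma>] y S_sub by blast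
    then obtain d where d: "d \<in> ?A" "inoue_phi0 \<alpha> y \<in> chart_im d"
      using chart by blast
    have "\<alpha> * (- s * h d (inoue_phi0 \<alpha> y)) = - s * (\<alpha> * h d (inoue_phi0 \<alpha> y))"
      by simp
    also have "\<dots> = s * h c y"
      unfolding h_phi0[OF c(1) d(1) c(2) d(2)] by simp
    finally have "\<alpha> * (- s * h d (inoue_phi0 \<alpha> y)) = s * h c y" .
    then have "\<alpha> * (- s * h d (inoue_phi0 \<alpha> y)) > 0"
      using c(3) by simp
    then have "- s * h d (inoue_phi0 \<alpha> y) > 0"
      using \<alpha> by (metis zero_less_mult_pos less_trans zero_less_one)
    then show ?thesis
      using d unfolding S_def by blast
  qed
  have "(\<i>, 0) \<in> inoue_space"
    by (simp add: inoue_space_def)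
  then have "(\<i>, 0) \<in> S 1 \<or> (\<i>, 0) \<in> S (-1)"
    using cover by blast
  then have "S 1 \<noteq> {}" "S (-1) \<noteq> {}"
    using swap[of _ 1] swap[of _ "-1"] by auto
  moreover have "S 1 \<inter> inoue_space = {} \<or> S (-1) \<inter> inoue_space = {}"
    by (rule connectedD[OF convex_connected[OF convex_inoue_space] open_S open_S disjoint cover])
  ultimately show False
    using S_sub[of 1] S_sub[of "-1"] by blast
qed

lemma para_hypercomplex_constant:
  "para_hypercomplex (quot_topology \<Gamma> inoue_space) (quot_atlas \<Gamma> inoue_space)
    (\<lambda>_ _. para_J1) (\<lambda>_ _. para_J2) (\<lambda>_ _. para_J3)"
proof -
  have endo: "smooth_endomorphism (quot_atlas \<Gamma> inoue_space) (\<lambda>_ _. J)"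
    if J: "linear J" "\<And>t e y v. J (alin t e y v) = alin t e y (J v)" for J
  proof (rule smooth_endomorphism_const[OF J(1)])
    fix g assume g: "g \<in> carrier \<Gamma>"
    obtain t e y k where "\<forall>v\<in>inoue_space. g v = alin t e y v + k"
      using \<Gamma>_affine[OF g] by blast
    then show "\<exists>L k. linear L \<and> (\<forall>x\<in>inoue_space. g x = L x + k) \<and> (\<forall>v. J (L v) = L (J v))"
      using J(2) linear_alin by blast
  qed
  have "para_J1 (para_J1 v) = - v \<and> para_J2 (para_J2 v) = v \<and> para_J3 (para_J3 v) = v \<and>
      para_J1 (para_J2 v) = - para_J2 (para_J1 v) \<and> para_J1 (para_J2 v) = para_J3 v" for v
    by (cases v) (simp add: para_J1_def para_J2_def para_J3_def complex_eq_iff)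
  moreover have "DIM(complex \<times> complex) = 4"
    by simp
  ultimately show ?thesis
    unfolding para_hypercomplex_def almost_para_hypercomplex_def
    using smooth_manifold_quot endo[OF linear_para(1) para_alin(1)]
      endo[OF linear_para(2) para_alin(2)] endo[OF linear_para(3) para_alin(3)]
      integrable_endomorphism_const[OF linear_para(1)]
      integrable_endomorphism_const[OF linear_para(2)]
      integrable_endomorphism_const[OF linear_para(3)]
    by blast
qed

end

theorem mainTheorem1:
  fixes p q r :: int and N :: "int^2^2" and \<alpha> A :: real and a b c :: "real^2"
  assumes "r \<noteq> 0"
    and "det N = -1"
    and "\<alpha> > 1"
    and "a \<noteq> 0" and "(\<chi> i j. real_of_int (N$i$j)) *v a = \<alpha> *\<^sub>R a"
    and "b \<noteq> 0" and "(\<chi> i j. real_of_int (N$i$j)) *v b = (- 1 / \<alpha>) *\<^sub>R b"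
    and "A = inoue_A r a b"
    and "\<And>i. - c$i = real_of_int (N$i$1) * c$1 + real_of_int (N$i$2) * c$2
                   + inoue_e N a b $ i + A * real_of_int ((vector [p, q] :: int^2) $ i)"
  shows "\<exists>J1 J2 J3.
           para_hypercomplex (inoue_topology \<alpha> a b c A) (inoue_atlas \<alpha> a b c A) J1 J2 J3 \<and>
           \<not> (\<exists>g. compatible_metric (inoue_atlas \<alpha> a b c A) J1 J2 J3 g)"
proof -
  interpret inoue_surface p q r N \<alpha> A a b c
    using assms by unfold_locales
  show ?thesis
    unfolding inoue_topology_def inoue_atlas_def
    using para_hypercomplex_constant no_compatible_metric by blast
qed

end
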